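(* Let $d\ge1$, $r>0$, $s\in[r,d+r)$ and let $q$ be defined by $1-q=\frac{d+r}{d+r-s}$ (so $q=-\frac{s}{d+r-s}<0$). Let $X$ be an $\mathbb{R}^d$-valued random vector with distribution $P=f\cdot\lambda_d$ such that $\mathbb{E}|X|^{r+\delta}<+\infty$ for some $\delta>0$ with $r+\delta>\frac{sd}{d+r-s}$. Let $\eta\in\big(0,\,r+\delta-\frac{sd}{d+r-s}\big)$, $p'=\frac{r+\delta-\eta}{d|q|}$ and $q'=\frac{r+\delta-\eta}{r+\delta-\eta-d|q|}$, and let $(\Gamma^n)_{n\ge1}$ be a sequence of $L^r$-optimal quantizers of $X$. Then there exist finite constants $C_1,C_2$, not depending on $n$, $\theta$ and $\mu$, such that for every $\theta>0$ and $\mu\in\mathbb{R}^d$ satisfying $$\int_{\{f>0\}}\Big(\frac{f_{\theta,\mu}}{f}\Big)^{(1-q)q'}f\,d\lambda_d<+\infty ,$$ one has, for every $n\ge1$, $$e_s\big(\Gamma^n_{\theta,\mu},P\big)\le\widetilde\kappa\;\theta^{1+\frac ds}\,\sigma_{r+\delta}(P)\left(\int_{\{f>0\}}\Big(\frac{f_{\theta,\mu}}{f}\Big)^{(1-q)q'}f\,d\lambda_d\right)^{\frac{1}{|q|q'(d+r)}}n^{-\frac1d},$$ where $\sigma_{r+\delta}(P)=\inf_{b\in\mathbb{R}^d}\big(\mathbb{E}|X-b|^{r+\delta}\big)^{\frac{1}{r+\delta}}$ and $$\widetilde\kappa=2^{\frac{2qp'-1}{qp'(d+r)}}\left(\fr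ac{(2^r-1)C_1^r+2^rC_2^r}{V_d}\right)^{\frac1{d+r}}\min_{\varepsilon\in(0,\frac13)}\Big[(1+\varepsilon)\varphi_r(\varepsilon)^{-\frac1{d+r}}\Big]\left(\int_{\mathbb{R}^d}(1\vee|x|)^{-d\frac{r+\delta}{r+\delta-\eta}}dx\right)^{\frac1{d+r}}.$$
   Context: $|\cdot|$ is a fixed norm on $\mathbb{R}^d$, $\lambda_d$ is Lebesgue measure on $\mathbb{R}^d$, $V_d$ is the $\lambda_d$-volume of the unit ball of $|\cdot|$, and $u\vee v=\max(u,v)$. For a finite set $\Gamma\subset\mathbb{R}^d$ and a probability distribution $P$ on $\mathbb{R}^d$ (the law of $X$), the $L^s$-quantization error is $e_s(\Gamma,P)=e_s(\Gamma,X)=\big(\int \min_{x\in\Gamma}|\xi-x|^s\,dP(\xi)\big)^{1/s}$. A sequence of $L^r$-optimal quantizers of $X$ is a sequence of sets $\Gamma^n\subset\mathbb{R}^d$ with $\operatorname{card}(\Gamma^n)\le n$ and $e_r(\Gamma^n,X)=\inf\{e_r(\Gamma,X):\operatorname{card}(\Gamma)\le n\}$ for every $n\ge1$. For $\theta>0$, $\mu\in\mathbb{R}^d$: $\Gamma^n_{\theta,\mu}=\{\mu+\theta(x-\mu):x\in\Gamma^n\}$ and $f_{\theta,\mu}(x)=f(\mu+\theta(x-\mu))$. Also $\varphi_r(u)=\big(\frac1{3^r}-u^r\big)u^d$ for $u\in(0,\frac13)$.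
   Formalization: The formal theorem also requires of θ, μ that f_{θ,μ}=0 almost everywhere on {f=0}; without this the claim fails, e.g. P uniform on [0,1], r=s=δ=1, η=1/2, θ=1/2, μ=100, where the integral is 0 but the error is positive. *)

theory Defs
  imports "HOL-Probability.Probability"
begin

(* An arbitrary norm on R^d.  The class-level norm of real^'d is the Euclidean one. *)
definition is_norm :: "(real^'d \<Rightarrow> real) \<Rightarrow> bool" where
  "is_norm N \<longleftrightarrow>
     (\<forall>x. 0 \<le> N x) \<and> (\<forall>x. N x = 0 \<longleftrightarrow> x = 0) \<and>
     (\<forall>a x. N (a *\<^sub>R x) = \<bar>a\<bar> * N x) \<and> (\<forall>x y. N (x + y) \<le> N x + N y)"

definition unit_ball_volume :: "(real^'d \<Rightarrow> real) \<Rightarrow> real" where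
  "unit_ball_volume N = measure lborel {x. N x \<le> 1}"

(* Real-valued: only meaningful for nonempty finite G and for P with a finite moment of
   order s, in which case the integrand is integrable. *)
definition quant_error ::
    "(real^'d \<Rightarrow> real) \<Rightarrow> real \<Rightarrow> (real^'d) set \<Rightarrow> (real^'d) measure \<Rightarrow> real" where
  "quant_error N s G P = (\<integral>\<xi>. (MIN x\<in>G. N (\<xi> - x) powr s) \<partial>P) powr (1 / s)"

(* The empty quantizer is excluded, since its error would be infinite. *)
definition quantizers :: "nat \<Rightarrow> (real^'d) set set" where
  "quantizers n = {G. finite G \<and> G \<noteq> {} \<and> card G \<le> n}"

definition optimal_quantizers ::
    "(real^'d \<Rightarrow> real) \<Rightarrow> real \<Rightarrow> (real^'d) measure \<Rightarrow> (nat \<Rightarrow> (real^'d) set) \<Rightarrow> bool" where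
  "optimal_quantizers N r P \<Gamma> \<longleftrightarrow>
     (\<forall>n\<ge>1. \<Gamma> n \<in> quantizers n \<and>
            quant_error N r (\<Gamma> n) P = (INF G\<in>quantizers n. quant_error N r G P))"

definition dilation :: "real \<Rightarrow> real^'d \<Rightarrow> real^'d \<Rightarrow> real^'d" where
  "dilation \<theta> \<mu> x = \<mu> + \<theta> *\<^sub>R (x - \<mu>)"

(* f(mu + theta (x - mu)) vanishes almost everywhere on {f = 0}: the measure with this density
   is absolutely continuous with respect to f * lborel, so that the quotient
   f(mu + theta (x - mu)) / f(x) on {f > 0} is its Radon-Nikodym derivative. *)
definition admissible :: "(real^'d \<Rightarrow> real) \<Rightarrow> real \<Rightarrow> real^'d \<Rightarrow> bool" where
  "admissible f \<theta> \<mu> \<longleftrightarrow> (AE x in lborel. f x = 0 \<longrightarrow> f (dilation \<theta> \<mu> x) = 0)"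

definition ratio_integrand ::
    "(real^'d \<Rightarrow> real) \<Rightarrow> real \<Rightarrow> real \<Rightarrow> real^'d \<Rightarrow> real^'d \<Rightarrow> real" where
  "ratio_integrand f a \<theta> \<mu> x = (f (dilation \<theta> \<mu> x) / f x) powr a * f x"

definition sigma_moment :: "(real^'d \<Rightarrow> real) \<Rightarrow> real \<Rightarrow> (real^'d) measure \<Rightarrow> real" where
  "sigma_moment N \<rho> P = (INF b. (\<integral>\<xi>. N (\<xi> - b) powr \<rho> \<partial>P) powr (1 / \<rho>))"

definition phi :: "real \<Rightarrow> nat \<Rightarrow> real \<Rightarrow> real" where
  "phi r d u = (1 / 3 powr r - u powr r) * u ^ d"

(* The infimum is a minimum, see min_phi_attained below. *)
definition min_phi :: "real \<Rightarrow> nat \<Rightarrow> real" where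
  "min_phi r d = (INF \<epsilon>\<in>{0<..<1/3}. (1 + \<epsilon>) * phi r d \<epsilon> powr (- 1 / (real d + r)))"

definition kappa ::
    "(real^'d \<Rightarrow> real) \<Rightarrow> real \<Rightarrow> real \<Rightarrow> real \<Rightarrow> real \<Rightarrow> real \<Rightarrow> real \<Rightarrow> real \<Rightarrow> real" where
  "kappa N r \<delta> \<eta> q p' C\<^sub>1 C\<^sub>2 = (let d = real CARD('d) in
     2 powr ((2 * q * p' - 1) / (q * p' * (d + r))) *
     (((2 powr r - 1) * C\<^sub>1 powr r + 2 powr r * C\<^sub>2 powr r) / unit_ball_volume N)
       powr (1 / (d + r)) *
     min_phi r CARD('d) *
     (\<integral>x. max 1 (N x) powr (- d * ((r + \<delta>) / (r + \<delta> - \<eta>))) \<partial>lborel)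
       powr (1 / (d + r)))"

lemma min_phi_attained:
  assumes r: "r > 0" and d: "d \<ge> 1"
  shows "\<exists>\<epsilon>\<in>{0<..<1/3}. min_phi r d = (1 + \<epsilon>) * phi r d \<epsilon> powr (- 1 / (real d + r)) \<and>
    (\<forall>u\<in>{0<..<1/3}. min_phi r d \<le> (1 + u) * phi r d u powr (- 1 / (real d + r)))"
proof -
  define a where "a = 1 / (real d + r)"
  have a: "a > 0" using r by (simp add: a_def)
  define k where "k u = phi r d u powr a / (1 + u)" for u
  define g where "g u = (1 + u) * phi r d u powr (- 1 / (real d + r))" for u
  have pos: "phi r d u > 0" if "u \<in> {0<..<1/3}" for u
  proof -
    have "u powr r < (1/3) powr r" using that r by (intro powr_less_mono2) auto
    also have "\<dots> = 1 / 3 powr r" by (simp add: powr_divide)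
    finally show ?thesis using that by (simp add: phi_def)
  qed
  have nonneg: "phi r d u \<ge> 0" if "u \<in> {0..1/3}" for u
  proof -
    have "u powr r \<le> (1/3) powr r" using that r by (intro powr_mono2) auto
    also have "\<dots> = 1 / 3 powr r" by (simp add: powr_divide)
    finally show ?thesis using that by (simp add: phi_def)
  qed
  have gk: "g u = 1 / k u" for u
    by (simp add: g_def k_def a_def powr_minus_divide)
  have cont: "continuous_on {0..1/3} k"
    unfolding k_def using nonneg a r
    by (intro continuous_on_divide continuous_on_powr' continuous_intros)
       (auto simp: phi_def intro!: continuous_intros continuous_on_powr')
  have "\<exists>x\<in>{0..1/3::real}. \<forall>y\<in>{0..1/3}. k y \<le> k x"
    by (rule continuous_attains_sup[OF _ _ cont]) auto
  then obtain e where e: "e \<in> {0..1/3}" "\<And>y. y \<in> {0..1/3} \<Longrightarrow> k y \<le> k e" by blast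
  have kpos: "k u > 0" if "u \<in> {0<..<1/3}" for u
    using pos[OF that] that by (simp add: k_def)
  have "k e > 0" using kpos[of "1/6"] e(2)[of "1/6"] by auto
  moreover have "k 0 = 0" "k (1/3) = 0"
    using d by (auto simp: k_def phi_def powr_divide)
  ultimately have "e \<noteq> 0" "e \<noteq> 1/3" by force+
  then have ein: "e \<in> {0<..<1/3}" using e(1) by auto
  have le: "g e \<le> g u" if "u \<in> {0<..<1/3}" for u
    unfolding gk using kpos[OF that] e(2)[of u] that by (intro divide_left_mono) auto
  have "min_phi r d = g e"
    unfolding min_phi_def g_def[symmetric] using ein le by (intro cInf_eq_minimum) auto
  with ein le show ?thesis unfolding g_def by auto
qed

end

theory Submission
  imports Defs
begin

text \<open>Adding a point \<open>\<xi>\<close> to an optimal \<open>n\<close>-quantizer \<open>G\<close> decreases the \<open>r\<close>-th power distortion by at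
  most a constant times \<open>n powr (- 1 - r / d)\<close>: by submodularity and optimality the decrease is at
  most the loss caused by deleting any point of \<open>G\<close>, and a comparison with a good grid of at most
  \<open>n / 2\<close> points shows that some point can be deleted cheaply. The decrease is also at least a
  constant times \<open>dist(\<xi>, G) powr r * P (ball \<xi> (dist(\<xi>, G) / 4))\<close>. Averaging over \<open>\<xi>\<close> against a
  heavy-tailed density bounds a weighted \<open>P\<close>-integral of \<open>dist(x, G) powr (r + d)\<close>. The change of variables
  \<open>x \<mapsto> \<mu> + \<theta> (x - \<mu>)\<close> turns the error of the dilated quantizer into the integral of
  \<open>dist(x, G) powr s\<close> times the density ratio against \<open>P\<close>, to which Hoelder's inequality with three
  factors applies. The constants \<open>C\<^sub>1\<close> and \<open>C\<^sub>2\<close> are free to absorb every factor that does not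
  depend on \<open>n\<close>, \<open>\<theta>\<close> and \<open>\<mu>\<close>, because the remaining factors of \<open>kappa\<close> and \<open>sigma_moment\<close> are
  positive.\<close>

subsection \<open>Norms and distances to finite sets\<close>

text \<open>The distance is kept without a power so that one function serves both the exponent
  \<open>r\<close> of optimality and the exponent \<open>s\<close> of the error;
  \<open>Min_powr\<close> restores the powers.\<close>

definition gap :: "(real^'d \<Rightarrow> real) \<Rightarrow> (real^'d) set \<Rightarrow> real^'d \<Rightarrow> real" where
  "gap N G x = (MIN y\<in>G. N (x - y))"

locale norm_on =
  fixes N :: "real^'d \<Rightarrow> real"
  assumes is_norm: "is_norm N"
begin

lemma nonneg [simp]: "0 \<le> N x"
  and zero_iff [simp]: "N x = 0 \<longleftrightarrow> x = 0"
  and scale: "N (a *\<^sub>R x) = \<bar>a\<bar> * N x"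
  and triangle: "N (x + y) \<le> N x + N y"
  using is_norm by (auto simp: is_norm_def)

lemma zero [simp]: "N 0 = 0"
  by simp

lemma pos_iff [simp]: "0 < N x \<longleftrightarrow> x \<noteq> 0"
  using nonneg[of x] zero_iff[of x] by linarith

lemma minus [simp]: "N (- x) = N x"
  using scale[of "-1" x] by simp

lemma commute: "N (x - y) = N (y - x)"
  using minus[of "x - y"] by simp

lemma triangle_diff: "N (x - z) \<le> N (x - y) + N (y - z)"
  using triangle[of "x - y" "y - z"] by simp

lemma sum_le: "finite I \<Longrightarrow> N (\<Sum>i\<in>I. h i) \<le> (\<Sum>i\<in>I. N (h i))"
proof (induction I rule: finite_induct)
  case (insert i I)
  then show ?case using triangle[of "h i" "sum h I"] by (simp del: zero_iff)
qed simp

lemma upper_bound: "\<exists>c>0. \<forall>x. N x \<le> c * norm x"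
proof (intro exI conjI allI)
  let ?S = "\<Sum>i\<in>UNIV. N (axis i (1::real))"
  show "0 < 1 + ?S" by (intro add_pos_nonneg sum_nonneg) auto
  fix x :: "real^'d"
  have "N x = N (\<Sum>i\<in>UNIV. x $ i *\<^sub>R axis i 1)"
    using basis_expansion[of x] by (simp add: scalar_mult_eq_scaleR)
  also have "\<dots> \<le> (\<Sum>i\<in>UNIV. norm x * N (axis i 1))"
    by (intro order_trans[OF sum_le] sum_mono) (auto simp: scale intro!: mult_right_mono component_le_norm_cart)
  also have "\<dots> = norm x * ?S" by (simp add: sum_distrib_left)
  also have "\<dots> \<le> norm x * (1 + ?S)" by (intro mult_left_mono) auto
  finally show "N x \<le> (1 + ?S) * norm x" by (simp add: mult.commute)
qed

lemma continuous: "continuous_on S N"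
proof -
  obtain c where c: "c > 0" "\<And>x. N x \<le> c * norm x" using upper_bound by blast
  have "c-lipschitz_on S N"
  proof (rule lipschitz_onI)
    fix x y
    have "N x \<le> N (x - y) + N y" "N y \<le> N (x - y) + N x"
      using triangle[of "x - y" y] triangle[of "y - x" x] by (simp_all add: commute)
    then show "dist (N x) (N y) \<le> c * dist x y"
      using c(2)[of "x - y"] by (auto simp: dist_norm)
  qed (use c in auto)
  then show ?thesis by (rule lipschitz_on_continuous_on)
qed

lemma measurable [measurable]: "N \<in> borel_measurable borel"
  by (intro borel_measurable_continuous_onI continuous)

text \<open>The constant is the minimum of \<open>N\<close> on the Euclidean unit sphere, which is
  compact; homogeneity carries the bound to all vectors.\<close>

lemma lower_bound: "\<exists>c>0. \<forall>x. c * norm x \<le> N x"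
proof -
  have "\<exists>x\<in>sphere 0 1. \<forall>y\<in>sphere 0 1. N x \<le> N y"
    by (intro continuous_attains_inf continuous compact_sphere) auto
  then obtain x where x: "norm x = 1" "\<And>y. norm y = 1 \<Longrightarrow> N x \<le> N y" by auto
  have "N x * norm y \<le> N y" for y
  proof (cases "y = 0")
    case False
    have "N y = norm y * N (sgn y)"
      using False by (simp add: sgn_div_norm scale)
    moreover have "N x \<le> N (sgn y)" using False by (intro x(2)) (simp add: norm_sgn)
    ultimately show ?thesis using mult_right_mono[of "N x" "N (sgn y)" "norm y"] by (simp add: mult.commute)
  qed simp
  moreover have "N x > 0" using x(1) by auto
  ultimately show ?thesis by blast
qed

text \<open>\<open>measure\<close> returns 0 on sets of infinite volume, so positivity takes two
  Euclidean balls: one inside the unit ball of \<open>N\<close>, and one around it to make the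
  volume finite.\<close>

lemma unit_ball_volume_pos: "0 < unit_ball_volume N"
proof -
  obtain c where c: "c > 0" "\<And>x. N x \<le> c * norm x" using upper_bound by blast
  obtain b where b: "b > 0" "\<And>x. b * norm x \<le> N x" using lower_bound by blast
  have "0 < measure lborel (cball (0::real^'d) (1 / c))"
    using c(1) by (subst content_cball) (auto intro!: mult_pos_pos unit_ball_vol_pos)
  also have "\<dots> \<le> measure lborel {x. N x \<le> 1}"
  proof (rule measure_mono_fmeasurable)
    show "cball 0 (1 / c) \<subseteq> {x. N x \<le> 1}"
    proof clarsimp
      fix x :: "real^'d" assume "norm x \<le> 1 / c"
      then have "c * norm x \<le> 1" using c(1) by (simp add: field_simps)
      with c(2)[of x] show "N x \<le> 1" by linarith
    qed
    have "{x. N x \<le> 1} \<subseteq> cball 0 (1 / b)"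
    proof clarsimp
      fix x :: "real^'d" assume "N x \<le> 1"
      with b(2)[of x] have "b * norm x \<le> 1" by linarith
      then show "norm x \<le> 1 / b" using b(1) by (simp add: field_simps)
    qed
    moreover have "cball 0 (1 / b) \<in> fmeasurable lborel"
      using b(1) by (intro fmeasurableI) (simp_all add: emeasure_cball)
    moreover have "{x. N x \<le> 1} \<in> sets lborel" by measurable
    ultimately show "{x. N x \<le> 1} \<in> fmeasurable lborel"
      using fmeasurableI2 by blast
    show "cball (0::real^'d) (1 / c) \<in> sets lborel" by simp
  qed
  finally show ?thesis by (simp add: unit_ball_volume_def)
qed

lemma emeasure_ball_ge: "\<exists>c>0. \<forall>x t. 0 \<le> t \<longrightarrow> ennreal (c * t ^ CARD('d)) \<le> emeasure lborel {y. N (x - y) \<le> t}"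
proof -
  obtain c where c: "c > 0" "\<And>x. N x \<le> c * norm x" using upper_bound by blast
  let ?v = "unit_ball_vol (real CARD('d)) / c ^ CARD('d)"
  have "ennreal (?v * t ^ CARD('d)) \<le> emeasure lborel {y. N (x - y) \<le> t}" if "0 \<le> t" for x t
  proof -
    have "ennreal (?v * t ^ CARD('d)) = emeasure lborel (cball x (t / c))"
      using that c(1) by (simp add: emeasure_cball power_divide)
    also have "\<dots> \<le> emeasure lborel {y. N (x - y) \<le> t}"
    proof (rule emeasure_mono)
      show "cball x (t / c) \<subseteq> {y. N (x - y) \<le> t}"
      proof clarsimp
        fix y assume "dist x y \<le> t / c"
        then have "c * norm (x - y) \<le> t" using c(1) by (simp add: field_simps dist_norm)
        with c(2)[of "x - y"] show "N (x - y) \<le> t" by linarith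
      qed
    qed measurable
    finally show ?thesis .
  qed
  moreover have "?v > 0" using c(1) by simp
  ultimately show ?thesis by blast
qed

context
  fixes G :: "(real^'d) set"
  assumes G: "finite G" "G \<noteq> {}"
begin

lemma gap_le: "y \<in> G \<Longrightarrow> gap N G x \<le> N (x - y)"
  unfolding gap_def using G by (intro Min_le) auto

lemma gap_attained: "\<exists>y\<in>G. gap N G x = N (x - y)"
proof -
  have "gap N G x \<in> (\<lambda>y. N (x - y)) ` G" unfolding gap_def using G by (intro Min_in) auto
  then show ?thesis by blast
qed

lemma gap_nonneg: "0 \<le> gap N G x"
  using gap_attained[of x] by auto

lemma gap_lipschitz: "gap N G x \<le> gap N G y + N (x - y)"
proof -
  obtain z where "z \<in> G" "gap N G y = N (y - z)" using gap_attained[of y] by auto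
  then show ?thesis using gap_le[of z x] triangle_diff[of x z y] by linarith
qed

lemma gap_insert: "gap N (insert \<xi> G) x = min (N (x - \<xi>)) (gap N G x)"
  unfolding gap_def using G by simp

lemma gap_measurable [measurable]: "gap N G \<in> borel_measurable borel"
  unfolding gap_def using G by measurable

lemma Min_powr: "0 < p \<Longrightarrow> (MIN y\<in>G. N (x - y) powr p) = gap N G x powr p"
proof (rule Min_eqI)
  assume p: "0 < p"
  show "gap N G x powr p \<in> (\<lambda>y. N (x - y) powr p) ` G" using gap_attained[of x] by auto
  fix z assume "z \<in> (\<lambda>y. N (x - y) powr p) ` G"
  then show "gap N G x powr p \<le> z" using p gap_le gap_nonneg by (auto intro!: powr_mono2)
qed (use G in auto)

end

lemma gap_antimono:
  assumes "finite H" "G \<subseteq> H" "G \<noteq> {}"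
  shows "gap N H x \<le> gap N G x"
proof -
  have "finite G" using assms finite_subset by blast
  then obtain y where "y \<in> G" "gap N G x = N (x - y)" using gap_attained assms by blast
  then show ?thesis using gap_le[of H y x] assms by auto
qed

end

subsection \<open>Grids and integrals of powers\<close>

text \<open>Mean value theorem: the derivative of the decreasing convex power is steepest at the
  left end \<open>a\<close>. This controls the spacing of the transformed grid.\<close>

lemma convex_powr_neg_diff:
  fixes a b p :: real
  assumes "0 < a" "a \<le> b" "0 < p"
  shows "a powr (-p) - b powr (-p) \<le> p * a powr (-p - 1) * (b - a)"
proof (cases "a = b")
  case False
  then have ab: "a < b" using assms by simp
  obtain z where z: "a < z" "z < b" "b powr (-p) - a powr (-p) = (b - a) * ((-p) * z powr (-p - 1))"
    using MVT2[OF ab, of "\<lambda>x. x powr (-p)" "\<lambda>x. (-p) * x powr (-p - 1)"] assms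
    by (force intro!: derivative_eq_intros)
  have "z powr (-p - 1) \<le> a powr (-p - 1)"
    using z assms by (intro powr_mono2') auto
  then have "(b - a) * (p * z powr (-p - 1)) \<le> (b - a) * (p * a powr (-p - 1))"
    using ab assms by (intro mult_left_mono) auto
  with z(3) show ?thesis by (simp add: mult_ac)
qed simp

text \<open>The grid is the image of the multiples of \<open>1/m\<close> in \<open>(0, 1]\<close> under the inverse of
  \<open>t \<mapsto> (1 + t) powr (-\<beta>)\<close>, a decreasing bijection of the half line onto \<open>(0, 1]\<close>.\<close>
lemma grid_real:
  fixes m :: nat and \<beta> :: real
  assumes m: "1 \<le> m" and \<beta>: "0 < \<beta>"
  obtains T :: "real set" where "finite T" "T \<noteq> {}" "card T \<le> 2 * m - 1"
    "\<And>t. \<exists>u\<in>T. \<bar>t - u\<bar> \<le> (1 + \<bar>t\<bar>) powr (1 + \<beta>) / (\<beta> * m)"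
proof -
  define g where "g k = (real k / m) powr (- 1 / \<beta>) - 1" for k :: nat
  \<comment> \<open>Since \<open>g m = 0\<close>, only the indices below \<open>m\<close> are taken,
    giving at most \<open>m - 1\<close> points; with their mirror images and 0 the total is at most
    \<open>2 * m - 1\<close>.\<close>
  define T where "T = insert 0 (g ` {1..<m} \<union> (\<lambda>k. - g k) ` {1..<m})"
  have gm: "g m = 0" using m by (simp add: g_def)
  have "card T \<le> Suc (card (g ` {1..<m} \<union> (\<lambda>k. - g k) ` {1..<m}))"
    unfolding T_def by (rule card_insert_le_m1) auto
  also have "\<dots> \<le> Suc (card (g ` {1..<m}) + card ((\<lambda>k. - g k) ` {1..<m}))"
    by (simp add: card_Un_le)
  also have "\<dots> \<le> Suc ((m - 1) + (m - 1))"
    using card_image_le[of "{1..<m}" g] card_image_le[of "{1..<m}" "\<lambda>k. - g k"] by simp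
  also have "\<dots> = 2 * m - 1" using m by simp
  finally have "card T \<le> 2 * m - 1" .
  moreover have "\<exists>u\<in>T. \<bar>t - u\<bar> \<le> (1 + \<bar>t\<bar>) powr (1 + \<beta>) / (\<beta> * m)" for t
  proof -
    define v where "v = (1 + \<bar>t\<bar>) powr (-\<beta>)"
    have v: "0 < v" "v \<le> 1" using \<beta> by (auto simp: v_def powr_minus intro!: inverse_le_1_iff[THEN iffD2] ge_one_powr_ge_zero)
    have vt: "v powr (- (1 / \<beta>)) = 1 + \<bar>t\<bar>" "v powr (- (1 / \<beta>) - 1) = (1 + \<bar>t\<bar>) powr (1 + \<beta>)"
      using \<beta> by (simp_all add: v_def powr_powr right_diff_distrib)
    \<comment> \<open>Rounding up keeps \<open>k\<close> at least 1 and \<open>k / m\<close> at or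
      above \<open>v\<close>, so the mean value bound is taken at \<open>v\<close> and reads in
      terms of \<open>t\<close> itself.\<close>
    define k where "k = nat \<lceil>m * v\<rceil>"
    have k: "1 \<le> k" "k \<le> m" "v \<le> k / m" "k / m \<le> v + 1 / m"
    proof -
      have "0 < m * v" using m v by simp
      then have "0 < \<lceil>m * v\<rceil>" by simp
      then show "1 \<le> k" unfolding k_def by linarith
      have "m * v \<le> m" using v by (intro mult_left_le) auto
      then show "k \<le> m" unfolding k_def by linarith
      have "m * v \<le> k" "k \<le> m * v + 1"
        using \<open>0 < m * v\<close> by (auto simp: k_def intro: of_int_ceiling_le_add_one)
      then show "v \<le> k / m" "k / m \<le> v + 1 / m" using m by (auto simp: field_simps)
    qed
    have "(k / m) powr (- (1 / \<beta>)) \<le> v powr (- (1 / \<beta>))"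
      using k v \<beta> by (intro powr_mono2') auto
    then have g_le: "g k \<le> \<bar>t\<bar>" by (simp add: g_def vt)
    have "\<bar>t\<bar> - g k = v powr (- (1 / \<beta>)) - (k / m) powr (- (1 / \<beta>))"
      by (simp add: g_def vt)
    also have "\<dots> \<le> 1 / \<beta> * v powr (- (1 / \<beta>) - 1) * (k / m - v)"
      using v k \<beta> by (intro convex_powr_neg_diff) auto
    also have "\<dots> \<le> 1 / \<beta> * v powr (- (1 / \<beta>) - 1) * (1 / m)"
      using k \<beta> by (intro mult_left_mono) auto
    also have "\<dots> = (1 + \<bar>t\<bar>) powr (1 + \<beta>) / (\<beta> * m)"
      by (simp add: vt)
    finally have *: "\<bar>\<bar>t\<bar> - g k\<bar> \<le> (1 + \<bar>t\<bar>) powr (1 + \<beta>) / (\<beta> * m)"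
      using g_le by simp
    have "g k \<in> T" "- g k \<in> T" using k gm by (cases "k = m"; force simp: T_def)+
    with * show ?thesis
      by (cases "0 \<le> t") (force intro: bexI[of _ "g k"] bexI[of _ "- g k"])+
  qed
  ultimately show ?thesis using that[of T] by (simp add: T_def)
qed

text \<open>The grid is a \<open>d\<close>-fold product of the real one, with at most
  \<open>2 * m - 1\<close> values per coordinate, where \<open>m\<close> is about half the
  \<open>d\<close>-th root of \<open>n\<close>.\<close>

lemma grid_vec:
  fixes \<beta> :: real
  assumes \<beta>: "0 < \<beta>"
  shows "\<exists>C>0. \<forall>n\<ge>1. \<exists>H::(real^'d) set. finite H \<and> H \<noteq> {} \<and> card H \<le> n \<and>
    (\<forall>x. \<exists>y\<in>H. norm (x - y) \<le> C * real n powr (- 1 / CARD('d)) * (1 + norm x) powr (1 + \<beta>))"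
proof (intro exI[of _ "4 * real CARD('d) / \<beta>"] conjI allI impI)
  let ?d = "real CARD('d)"
  show "0 < 4 * ?d / \<beta>" using \<beta> by simp
  fix n :: nat assume n: "1 \<le> n"
  \<comment> \<open>Halving makes \<open>2 * m - 1\<close> at most the \<open>d\<close>-th root of
    \<open>n\<close>; the floor and the halving cost the factor 4 in \<open>m_ge\<close>, and
    \<open>max 1\<close> handles small \<open>n\<close>.\<close>
  define m where "m = max 1 (nat \<lfloor>real n powr (1 / ?d) / 2\<rfloor>)"
  have m: "1 \<le> m" by (simp add: m_def)
  have n1: "1 \<le> real n powr (1 / ?d)" using n by (intro ge_one_powr_ge_zero) auto
  have m_ge: "real n powr (1 / ?d) \<le> 4 * m"
    using n1 unfolding m_def by linarith
  have m_le: "(2 * m - 1) ^ CARD('d) \<le> n"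
  proof (cases "m = 1")
    case False
    then have "real m \<le> real n powr (1 / ?d) / 2" unfolding m_def by linarith
    then have "real (2 * m - 1) \<le> real n powr (1 / ?d)" by linarith
    then have "real (2 * m - 1) ^ CARD('d) \<le> (real n powr (1 / ?d)) ^ CARD('d)"
      by (intro power_mono) auto
    also have "\<dots> = real n" using n by (simp add: powr_powr flip: powr_realpow)
    finally show ?thesis by (simp flip: of_nat_power)
  qed (use n in simp)
  obtain T where T: "finite T" "T \<noteq> {}" "card T \<le> 2 * m - 1"
    "\<And>t. \<exists>u\<in>T. \<bar>t - u\<bar> \<le> (1 + \<bar>t\<bar>) powr (1 + \<beta>) / (\<beta> * m)"
    using grid_real[OF m \<beta>] by blast
  define H where "H = {x::real^'d. \<forall>i. x $ i \<in> T}"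
  have H_eq: "H = vec_lambda ` (UNIV \<rightarrow>\<^sub>E T)"
  proof (intro set_eqI iffI)
    fix x assume "x \<in> H"
    then have "vec_nth x \<in> UNIV \<rightarrow>\<^sub>E T" by (simp add: H_def PiE_def extensional_def)
    then show "x \<in> vec_lambda ` (UNIV \<rightarrow>\<^sub>E T)"
      using vec_nth_inverse[of x] by (metis image_eqI)
  qed (auto simp: H_def)
  have "card H = card T ^ CARD('d)"
    unfolding H_eq by (subst card_image) (auto simp: inj_on_def card_PiE vec_lambda_inject)
  also have "\<dots> \<le> (2 * m - 1) ^ CARD('d)" using T by (intro power_mono) auto
  finally have "card H \<le> n" using m_le by linarith
  moreover have "finite H" unfolding H_eq using T by (intro finite_imageI finite_PiE) auto
  moreover have near: "\<exists>y\<in>H. norm (x - y) \<le> 4 * ?d / \<beta> * real n powr (- 1 / ?d) * (1 + norm x) powr (1 + \<beta>)" for x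
  proof -
    obtain u where u: "\<And>t. u t \<in> T" "\<And>t. \<bar>t - u t\<bar> \<le> (1 + \<bar>t\<bar>) powr (1 + \<beta>) / (\<beta> * m)"
      using T(4) by metis
    define y where "y = (\<chi> i. u (x $ i))"
    have "norm (x - y) \<le> (\<Sum>i\<in>UNIV. \<bar>(x - y) $ i\<bar>)" by (rule norm_le_l1_cart)
    also have "\<dots> \<le> (\<Sum>i\<in>(UNIV::'d set). (1 + norm x) powr (1 + \<beta>) / (\<beta> * m))"
    proof (rule sum_mono)
      fix i
      have "\<bar>(x - y) $ i\<bar> \<le> (1 + \<bar>x $ i\<bar>) powr (1 + \<beta>) / (\<beta> * m)" using u(2) by (simp add: y_def)
      also have "\<dots> \<le> (1 + norm x) powr (1 + \<beta>) / (\<beta> * m)"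
        using \<beta> by (intro divide_right_mono powr_mono2) (auto simp: component_le_norm_cart)
      finally show "\<bar>(x - y) $ i\<bar> \<le> (1 + norm x) powr (1 + \<beta>) / (\<beta> * m)" .
    qed
    also have "\<dots> = ?d / \<beta> * (1 / m) * (1 + norm x) powr (1 + \<beta>)" by simp
    also have "\<dots> \<le> ?d / \<beta> * (4 * real n powr (- 1 / ?d)) * (1 + norm x) powr (1 + \<beta>)"
    proof (intro mult_right_mono mult_left_mono)
      show "1 / real m \<le> 4 * real n powr (- 1 / ?d)"
        using m_ge m n by (simp add: powr_minus divide_simps)
    qed (use \<beta> in auto)
    finally show ?thesis using u(1) by (intro bexI[of _ y]) (auto simp: H_def y_def mult_ac)
  qed
  moreover have "H \<noteq> {}" using near[of 0] by auto
  ultimately show "\<exists>H::(real^'d) set. finite H \<and> H \<noteq> {} \<and> card H \<le> n \<and>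
    (\<forall>x. \<exists>y\<in>H. norm (x - y) \<le> 4 * ?d / \<beta> * real n powr (- 1 / ?d) * (1 + norm x) powr (1 + \<beta>))"
    by blast
qed

section \<open>Integrability of the heavy-tailed weight\<close>

lemma nn_integral_max_powr_real:
  fixes a :: real assumes a: "1 < a"
  shows "(\<integral>\<^sup>+t. ennreal (max 1 \<bar>t\<bar> powr (- a)) \<partial>lborel) < \<infinity>"
proof -
  let ?h = "\<lambda>t. ennreal (t powr (- a)) * indicator {1..} t"
  have "(\<integral>\<^sup>+t. ?h t \<partial>lborel) = ennreal (0 - (1 powr (1 - a) / (1 - a)))"
  proof (rule nn_integral_FTC_atLeast[where F = "\<lambda>t. t powr (1 - a) / (1 - a)"])
    show "((\<lambda>t. t powr (1 - a) / (1 - a)) \<longlongrightarrow> 0) at_top"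
      using a by (intro tendsto_divide_zero tendsto_neg_powr filterlim_ident) auto
  qed (use a in \<open>auto intro!: derivative_eq_intros\<close>)
  then have fin: "(\<integral>\<^sup>+t. ?h t \<partial>lborel) < \<infinity>" by simp
  have "(\<integral>\<^sup>+t. ?h (- t) \<partial>lborel) = (\<integral>\<^sup>+t. ?h t \<partial>lborel)"
    by (subst (2) nn_integral_real_affine[of _ "-1" 0]) auto
  with fin have "(\<integral>\<^sup>+t. ?h t \<partial>lborel) + (\<integral>\<^sup>+t. ?h (- t) \<partial>lborel) + (\<integral>\<^sup>+t. indicator {-1..1::real} t \<partial>lborel) < \<infinity>"
    by simp
  also have "(\<integral>\<^sup>+t. ?h t \<partial>lborel) + (\<integral>\<^sup>+t. ?h (- t) \<partial>lborel) + (\<integral>\<^sup>+t. indicator {-1..1::real} t \<partial>lborel)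
      = (\<integral>\<^sup>+t. ?h t + ?h (- t) + indicator {-1..1} t \<partial>lborel)"
    by (simp add: nn_integral_add)
  finally have "(\<integral>\<^sup>+t. ?h t + ?h (- t) + indicator {-1..1} t \<partial>lborel) < \<infinity>" .
  moreover have "(\<integral>\<^sup>+t. ennreal (max 1 \<bar>t\<bar> powr (- a)) \<partial>lborel) \<le> (\<integral>\<^sup>+t. ?h t + ?h (- t) + indicator {-1..1} t \<partial>lborel)"
  proof (rule nn_integral_mono)
    fix t :: real
    consider "1 \<le> t" | "t \<le> -1" | "-1 < t" "t < 1" by linarith
    then show "ennreal (max 1 \<bar>t\<bar> powr (- a)) \<le> ?h t + ?h (- t) + indicator {-1..1} t"
      by cases (auto simp: max_def indicator_def)
  qed
  ultimately show ?thesis by (rule le_less_trans[rotated])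
qed

text \<open>The exponent \<open>d * a\<close> is shared among the \<open>d\<close> coordinates: each
  coordinate is at most the Euclidean norm, so the weight is dominated by a product of
  one-dimensional weights of exponent \<open>a > 1\<close>, whose integral factorises.\<close>

lemma (in norm_on) nn_integral_max_powr:
  fixes a :: real assumes a: "1 < a"
  shows "(\<integral>\<^sup>+x. ennreal (max 1 (N x) powr (- real CARD('d) * a)) \<partial>lborel) < \<infinity>"
proof -
  obtain c where c: "c > 0" "\<And>x. c * norm x \<le> N x" using lower_bound by blast
  define b where "b = min 1 c"
  have b: "0 < b" "b \<le> 1" "b \<le> c" using c by (auto simp: b_def)
  define K where "K = b powr (- real CARD('d) * a)"
  have bound: "max 1 (N x) powr (- real CARD('d) * a) \<le> K * (\<Prod>e\<in>Basis. max 1 \<bar>x \<bullet> e\<bar> powr (- a))" for x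
  proof -
    have "b * norm x \<le> N x" using c(2)[of x] b mult_right_mono[of b c "norm x"] by auto
    then have "b * max 1 (norm x) \<le> max 1 (N x)" using b by (auto simp: max_def)
    then have "max 1 (N x) powr (- real CARD('d) * a) \<le> (b * max 1 (norm x)) powr (- real CARD('d) * a)"
      using b a by (intro powr_mono2') auto
    also have "\<dots> = K * max 1 (norm x) powr (- real CARD('d) * a)"
      using b by (simp add: powr_mult K_def)
    also have "max 1 (norm x) powr (- real CARD('d) * a) = (\<Prod>e\<in>(Basis::(real^'d) set). max 1 (norm x) powr (- a))"
      by (simp add: powr_powr mult_ac flip: powr_realpow)
    also have "K * \<dots> \<le> K * (\<Prod>e\<in>Basis. max 1 \<bar>x \<bullet> e\<bar> powr (- a))"
      using a Basis_le_norm[of _ x] by (intro mult_left_mono prod_mono conjI powr_mono2') (auto simp: K_def intro: max.coboundedI2)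
    finally show ?thesis .
  qed
  have "(\<integral>\<^sup>+x. ennreal (max 1 (N x) powr (- real CARD('d) * a)) \<partial>lborel)
      \<le> (\<integral>\<^sup>+x. ennreal K * (\<Prod>e\<in>Basis. ennreal (max 1 \<bar>x \<bullet> e\<bar> powr (- a))) \<partial>(lborel :: (real^'d) measure))"
    using bound by (intro nn_integral_mono) (simp add: prod_ennreal K_def prod_nonneg flip: ennreal_mult)
  also have "\<dots> = ennreal K * (\<Prod>e\<in>(Basis::(real^'d) set). \<integral>\<^sup>+t. ennreal (max 1 \<bar>t\<bar> powr (- a)) \<partial>lborel)"
    by (simp add: nn_integral_cmult nn_integral_lborel_prod[of "\<lambda>_ t. ennreal (max 1 \<bar>t\<bar> powr (- a))"])
  also have "\<dots> < \<infinity>"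
    using nn_integral_max_powr_real[OF a] by (simp add: ennreal_mult_less_top power_less_top_ennreal)
  finally show ?thesis .
qed

section \<open>Hoelder's inequality with three factors\<close>

lemma weighted_am_gm3:
  fixes u v w a b c :: real
  assumes "0 \<le> u" "0 \<le> v" "0 \<le> w" and abc: "0 < a" "0 < b" "0 < c" "a + b + c = 1"
  shows "u powr a * v powr b * w powr c \<le> a * u + b * v + c * w"
proof (cases "u = 0 \<or> v = 0 \<or> w = 0")
  case False
  then have pos: "0 < u" "0 < v" "0 < w" using assms by auto
  define S where "S = a * u + b * v + c * w"
  have S: "0 < S" using pos abc by (auto simp: S_def intro!: add_pos_pos)
  \<comment> \<open>The tangent of \<open>ln\<close> at the weighted mean \<open>S\<close>; as the
    weights sum to one, the linear terms cancel in the weighted sum.\<close>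
  have ln: "ln x \<le> ln S + (x / S - 1)" if "0 < x" for x
    using ln_le_minus_one[of "x / S"] that S by (simp add: ln_div)
  have "a * ln u + b * ln v + c * ln w
      \<le> a * (ln S + (u / S - 1)) + b * (ln S + (v / S - 1)) + c * (ln S + (w / S - 1))"
    using pos abc by (intro add_mono mult_left_mono ln) auto
  also have "\<dots> = (a + b + c) * ln S + ((a * u + b * v + c * w) / S - (a + b + c))"
    by (simp add: algebra_simps add_divide_distrib)
  also have "\<dots> = ln S" using abc S by (simp flip: S_def)
  finally have "exp (a * ln u + b * ln v + c * ln w) \<le> S"
    using S by (metis exp_le_cancel_iff exp_ln)
  then show ?thesis using pos by (simp add: S_def powr_def exp_add)
qed (use assms in auto)

text \<open>Dividing each function by its bound reduces the claim to the pointwise weighted AM-GM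
  inequality. Positive bounds \<open>U\<close>, \<open>V\<close>, \<open>W\<close> in place of the
  integrals themselves avoid the cases where an integral is zero.\<close>

lemma nn_integral_Hoelder3:
  fixes u v w :: "'a \<Rightarrow> real" and a b c U V W :: real
  assumes [measurable]: "u \<in> borel_measurable M" "v \<in> borel_measurable M" "w \<in> borel_measurable M"
    and nn: "\<And>x. 0 \<le> u x" "\<And>x. 0 \<le> v x" "\<And>x. 0 \<le> w x"
    and abc: "0 < a" "0 < b" "0 < c" "a + b + c = 1"
    and pos: "0 < U" "0 < V" "0 < W"
    and le: "(\<integral>\<^sup>+x. u x \<partial>M) \<le> U" "(\<integral>\<^sup>+x. v x \<partial>M) \<le> V" "(\<integral>\<^sup>+x. w x \<partial>M) \<le> W"
  shows "(\<integral>\<^sup>+x. u x powr a * v x powr b * w x powr c \<partial>M) \<le> ennreal (U powr a * V powr b * W powr c)"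
proof -
  let ?K = "U powr a * V powr b * W powr c"
  have K: "0 \<le> ?K" by simp
  have "u x powr a * v x powr b * w x powr c \<le> ?K * (a / U * u x + b / V * v x + c / W * w x)" for x
  proof -
    have "u x powr a * v x powr b * w x powr c
        = ?K * ((u x / U) powr a * (v x / V) powr b * (w x / W) powr c)"
      using pos nn by (simp add: powr_divide)
    also have "\<dots> \<le> ?K * (a * (u x / U) + b * (v x / V) + c * (w x / W))"
      using pos nn abc by (intro mult_left_mono weighted_am_gm3) auto
    finally show ?thesis by simp
  qed
  then have "(\<integral>\<^sup>+x. u x powr a * v x powr b * w x powr c \<partial>M)
      \<le> (\<integral>\<^sup>+x. ennreal ?K * (ennreal (a / U) * u x + ennreal (b / V) * v x + ennreal (c / W) * w x) \<partial>M)"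
    using pos nn abc by (intro nn_integral_mono) (simp flip: ennreal_mult ennreal_plus)
  also have "\<dots> = ennreal ?K * (ennreal (a / U) * (\<integral>\<^sup>+x. u x \<partial>M) + ennreal (b / V) * (\<integral>\<^sup>+x. v x \<partial>M)
      + ennreal (c / W) * (\<integral>\<^sup>+x. w x \<partial>M))"
    by (simp add: nn_integral_cmult nn_integral_add)
  also have "\<dots> \<le> ennreal ?K * (ennreal (a / U) * ennreal U + ennreal (b / V) * ennreal V + ennreal (c / W) * ennreal W)"
    using le by (intro mult_left_mono add_mono) auto
  also have "\<dots> = ennreal ?K"
    using pos abc by (simp flip: ennreal_mult ennreal_plus)
  finally show ?thesis .
qed

lemma powr_sum_le:
  fixes a b p :: real
  assumes "0 \<le> a" "0 \<le> b" "0 < p"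
  shows "(a + b) powr p \<le> 2 powr p * (a powr p + b powr p)"
proof -
  have "(a + b) powr p \<le> (2 * max a b) powr p" using assms by (intro powr_mono2) auto
  also have "\<dots> = 2 powr p * max a b powr p" using assms by (simp add: powr_mult)
  also have "\<dots> \<le> 2 powr p * (a powr p + b powr p)"
    by (intro mult_left_mono) (auto simp: max_def)
  finally show ?thesis .
qed

lemma Diff_singleton_nonempty:
  assumes "2 \<le> card A"
  shows "A - {y} \<noteq> {}"
proof
  assume "A - {y} = {}"
  then have "A \<subseteq> {y}" by auto
  then have "card A \<le> card {y}" by (intro card_mono) auto
  with assms show False by simp
qed

subsection \<open>Distortion of optimal quantizers\<close>

text \<open>\<open>\<rho>\<close> is the order of the available moment, \<open>r + \<delta>\<close>
  in the final theorem.\<close>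

locale moment_space = norm_on N + prob_space P
  for N :: "real^'d \<Rightarrow> real" and P :: "(real^'d) measure" +
  fixes \<rho> :: real
  assumes sets_P [measurable_cong]: "sets P = sets borel"
    and \<rho>_pos: "0 < \<rho>"
    and moment: "integrable P (\<lambda>x. N x powr \<rho>)"
begin

text \<open>The error before the root \<open>1 / p\<close> is taken: differences of such errors are
  integrals of pointwise differences, and the minimisers are the same.\<close>

definition distortion :: "real \<Rightarrow> (real^'d) set \<Rightarrow> real" where
  "distortion p G = (\<integral>x. gap N G x powr p \<partial>P)"

lemma integrable_max: "integrable P (\<lambda>x. max 1 (N x) powr \<rho>)"
proof (rule Bochner_Integration.integrable_bound)
  show "integrable P (\<lambda>x. 1 + N x powr \<rho>)" using moment by simp
qed (auto simp: max_def)

lemma integrable_powr: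
  assumes [measurable]: "h \<in> borel_measurable borel"
    and h: "\<And>x. 0 \<le> h x" "\<And>x. h x \<le> K * max 1 (N x)" and p: "0 < p" "p \<le> \<rho>"
  shows "integrable P (\<lambda>x. h x powr p)"
proof (rule Bochner_Integration.integrable_bound)
  show "integrable P (\<lambda>x. \<bar>K\<bar> powr p * max 1 (N x) powr \<rho>)" using integrable_max by simp
  have "h x powr p \<le> \<bar>K\<bar> powr p * max 1 (N x) powr \<rho>" for x
  proof -
    have "h x \<le> \<bar>K\<bar> * max 1 (N x)"
      using h(2)[of x] by (rule order_trans) (intro mult_right_mono, auto)
    then have "h x powr p \<le> (\<bar>K\<bar> * max 1 (N x)) powr p" using h p by (intro powr_mono2) auto
    also have "\<dots> = \<bar>K\<bar> powr p * max 1 (N x) powr p" by (simp add: powr_mult)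
    also have "\<dots> \<le> \<bar>K\<bar> powr p * max 1 (N x) powr \<rho>"
      using p by (intro mult_left_mono powr_mono) auto
    finally show ?thesis .
  qed
  then show "AE x in P. norm (h x powr p) \<le> norm (\<bar>K\<bar> powr p * max 1 (N x) powr \<rho>)" by simp
qed simp

lemma gap_le_max:
  assumes "finite G" "y \<in> G"
  shows "gap N G x \<le> (1 + N y) * max 1 (N x)"
proof -
  have "gap N G x \<le> N (x - y)" using assms gap_le by blast
  also have "\<dots> \<le> N x + N y" using triangle[of x "- y"] by simp
  also have "\<dots> \<le> max 1 (N x) + N y * max 1 (N x)"
    using mult_left_mono[of 1 "max 1 (N x)" "N y"] by simp
  finally show ?thesis by (simp add: algebra_simps)
qed

lemma integrable_gap:
  assumes "finite G" "G \<noteq> {}" "0 < p" "p \<le> \<rho>"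
  shows "integrable P (\<lambda>x. gap N G x powr p)"
proof -
  obtain y where "y \<in> G" using assms by blast
  with assms show ?thesis
    by (intro integrable_powr[of _ "1 + N y"] gap_nonneg gap_le_max gap_measurable) auto
qed

lemma distortion_nonneg: "0 \<le> distortion p G"
  by (simp add: distortion_def)

text \<open>A Pierce-type bound: on a grid whose local spacing grows like
  \<open>(1 + norm x) powr (1 + \<beta>)\<close>, the \<open>r\<close>-th power of the distance is
  controlled by the moment of order \<open>\<rho>\<close>, uniformly in \<open>n\<close>.\<close>

lemma distortion_upper_bound:
  assumes r: "0 < r" "r < \<rho>"
  shows "\<exists>C>0. \<forall>n\<ge>1. \<exists>H. finite H \<and> H \<noteq> {} \<and> card H \<le> n \<and>
    distortion r H \<le> C * real n powr (- r / CARD('d))"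
proof -
  obtain c where c: "c > 0" "\<And>x. N x \<le> c * norm x" using upper_bound by blast
  obtain b where b: "b > 0" "\<And>x. b * norm x \<le> N x" using lower_bound by blast
  \<comment> \<open>Solves \<open>r * (1 + \<beta>) = \<rho>\<close>; its positivity is where
    \<open>r < \<rho>\<close> enters.\<close>
  define \<beta> where "\<beta> = \<rho> / r - 1"
  have \<beta>: "0 < \<beta>" using r by (simp add: \<beta>_def)
  obtain C where C: "C > 0" "\<And>n. 1 \<le> n \<Longrightarrow> \<exists>H::(real^'d) set. finite H \<and> H \<noteq> {} \<and> card H \<le> n \<and>
    (\<forall>x. \<exists>y\<in>H. norm (x - y) \<le> C * real n powr (- 1 / CARD('d)) * (1 + norm x) powr (1 + \<beta>))"
    using grid_vec[OF \<beta>] by blast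
  define I where "I = (\<integral>x. max 1 (N x) powr \<rho> \<partial>P)"
  have I: "1 \<le> I"
  proof -
    have "(\<integral>x. 1 \<partial>P) \<le> I" unfolding I_def
      using \<rho>_pos by (intro integral_mono integrable_max ge_one_powr_ge_zero) auto
    then show ?thesis by (simp add: prob_space)
  qed
  define K where "K = (c * C) powr r * (1 + 1 / b) powr \<rho>"
  have "0 < 1 + 1 / b" using b by (simp add: add_pos_pos)
  then have K: "0 < K" using c C by (simp add: K_def)
  have "\<exists>H. finite H \<and> H \<noteq> {} \<and> card H \<le> n \<and> distortion r H \<le> K * I * real n powr (- r / CARD('d))"
    if n: "1 \<le> n" for n
  proof -
    obtain H :: "(real^'d) set" where H: "finite H" "H \<noteq> {}" "card H \<le> n"
      "\<And>x. \<exists>y\<in>H. norm (x - y) \<le> C * real n powr (- 1 / CARD('d)) * (1 + norm x) powr (1 + \<beta>)"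
      using C(2)[OF n] by blast
    let ?e = "real n powr (- 1 / CARD('d))"
    have gap: "gap N H x powr r \<le> K * real n powr (- r / CARD('d)) * max 1 (N x) powr \<rho>" for x
    proof -
      obtain y where y: "y \<in> H" "norm (x - y) \<le> C * ?e * (1 + norm x) powr (1 + \<beta>)"
        using H(4) by blast
      have "norm x \<le> 1 / b * N x" using b(1) b(2)[of x] by (simp add: field_simps)
      also have "\<dots> \<le> 1 / b * max 1 (N x)" using b(1) by (intro mult_left_mono) auto
      finally have norm_le: "1 + norm x \<le> (1 + 1 / b) * max 1 (N x)" by (simp add: distrib_right)
      have "gap N H x \<le> c * norm (x - y)" using gap_le[OF H(1,2) y(1)] c(2) order_trans by blast
      also have "\<dots> \<le> c * (C * ?e * (1 + norm x) powr (1 + \<beta>))" using y c by simp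
      also have "\<dots> \<le> c * (C * ?e * ((1 + 1 / b) * max 1 (N x)) powr (1 + \<beta>))"
        using c C \<beta> norm_le by (intro mult_left_mono powr_mono2) auto
      finally have "gap N H x powr r \<le> (c * (C * ?e * ((1 + 1 / b) * max 1 (N x)) powr (1 + \<beta>))) powr r"
        using r gap_nonneg[OF H(1,2)] by (intro powr_mono2) auto
      also have "\<dots> = K * real n powr (- r / CARD('d)) * max 1 (N x) powr \<rho>"
        using c C b r by (simp add: powr_mult powr_powr \<beta>_def K_def)
      finally show ?thesis .
    qed
    have "distortion r H \<le> (\<integral>x. K * real n powr (- r / CARD('d)) * max 1 (N x) powr \<rho> \<partial>P)"
      unfolding distortion_def using r H gap by (intro integral_mono integrable_gap) (auto simp: integrable_max)
    then show ?thesis using H by (auto simp: I_def mult_ac)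
  qed
  moreover have "0 < K * I" using K I by simp
  ultimately show ?thesis by blast
qed

text \<open>The local search argument: only the points of \<open>G\<close> that are nearest to some point of \<open>H\<close>
  are needed to serve, within \<open>2 * gap N H x + gap N G x\<close>, every \<open>x\<close> whose own nearest point
  has been removed.\<close>
lemma cheap_removal:
  assumes r: "0 < r" "r \<le> \<rho>" and G: "finite G" and H: "finite H" "H \<noteq> {}"
    and card: "2 * card H \<le> card G" "2 \<le> card G"
  shows "\<exists>y\<in>G. distortion r (G - {y}) - distortion r G
    \<le> 2 / card G * (\<integral>x. (2 * gap N H x + gap N G x) powr r \<partial>P)"
proof -
  have G_ne: "G \<noteq> {}" using card by auto
  have G': "finite (G - {y})" "G - {y} \<noteq> {}" for y
    using G Diff_singleton_nonempty[OF card(2)] by auto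
  obtain \<sigma> where \<sigma>: "\<And>h. \<sigma> h \<in> G" "\<And>h. gap N G h = N (h - \<sigma> h)"
    using gap_attained[OF G G_ne] by metis
  \<comment> \<open>These are the points whose removal leaves every \<open>h\<close> in
    \<open>H\<close> its nearest point \<open>\<sigma> h\<close>. As \<open>H\<close> has at most
    half as many points as \<open>G\<close>, they make up at least half of \<open>G\<close>.\<close>
  define S where "S = G - \<sigma> ` H"
  have "card (\<sigma> ` H) \<le> card H" using H by (intro card_image_le)
  then have "card G \<le> 2 * card S"
    using card \<sigma>(1) H unfolding S_def by (subst card_Diff_subset) auto
  then have S: "card G \<le> 2 * card S" "S \<subseteq> G" "finite S" "0 < card S"
    using card G by (auto simp: S_def)
  let ?B = "\<lambda>x. (2 * gap N H x + gap N G x) powr r"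
  let ?L = "\<lambda>y x. gap N (G - {y}) x powr r - gap N G x powr r"
  \<comment> \<open>Only the removal of the chosen nearest point \<open>z\<close> of
    \<open>x\<close> can raise the gap at \<open>x\<close>, so at most one summand is
    positive.\<close>
  have pointwise: "(\<Sum>y\<in>S. ?L y x) \<le> ?B x" for x
  proof -
    obtain z where z: "z \<in> G" "gap N G x = N (x - z)" using gap_attained[OF G G_ne] by blast
    obtain h where h: "h \<in> H" "gap N H x = N (x - h)" using gap_attained[OF H] by blast
    have zero: "?L y x \<le> 0" if "y \<noteq> z" for y
    proof -
      have "gap N (G - {y}) x \<le> gap N G x" using z that G' by (simp add: gap_le)
      then show ?thesis using r G' by (auto intro!: powr_mono2 gap_nonneg)
    qed
    have main: "?L z x \<le> ?B x" if "z \<in> S"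
    proof -
      have "\<sigma> h \<in> G - {z}" using \<sigma>(1) that h by (auto simp: S_def)
      then have "gap N (G - {z}) x \<le> N (x - \<sigma> h)" using G' gap_le by blast
      \<comment> \<open>Detour through \<open>h\<close>: its nearest point \<open>\<sigma> h\<close>
        survives and is no farther from \<open>h\<close> than \<open>z\<close> is.\<close>
      also have "\<dots> \<le> N (x - h) + N (h - \<sigma> h)" by (rule triangle_diff)
      also have "N (h - \<sigma> h) \<le> N (h - z)" using \<sigma>(2) gap_le[OF G G_ne z(1)] by metis
      also have "N (h - z) \<le> N (x - h) + N (x - z)" using triangle_diff[of h z x] by (simp add: commute)
      finally have "gap N (G - {z}) x \<le> 2 * gap N H x + gap N G x" using z h by simp
      then have "gap N (G - {z}) x powr r \<le> ?B x"
        using r G' by (intro powr_mono2 gap_nonneg) auto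
      then show ?thesis by (smt (verit) powr_ge_zero)
    qed
    have "(\<Sum>y\<in>S. ?L y x) \<le> (\<Sum>y\<in>S. if y = z then ?B x else 0)"
      using zero main by (intro sum_mono) auto
    also have "\<dots> \<le> ?B x" using S by simp
    finally show ?thesis .
  qed
  obtain g where g: "g \<in> G" using G_ne by blast
  obtain h where h: "h \<in> H" using H by blast
  have int_B: "integrable P ?B"
  proof (rule integrable_powr[OF _ _ _ r, of _ "2 * (1 + N h) + (1 + N g)"])
    show "2 * gap N H x + gap N G x \<le> (2 * (1 + N h) + (1 + N g)) * max 1 (N x)" for x
      using gap_le_max[OF H(1) h, of x] gap_le_max[OF G g, of x] by (simp add: distrib_right)
  qed (use gap_nonneg G G_ne H gap_measurable in auto)
  have int_G: "integrable P (\<lambda>x. gap N G x powr r)" using G G_ne r by (rule integrable_gap)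
  have int_L: "integrable P (?L y)" for y
    using integrable_gap[OF G'[of y] r] int_G by simp
  have L: "distortion r (G - {y}) - distortion r G = (\<integral>x. ?L y x \<partial>P)" for y
    unfolding distortion_def using integrable_gap[OF G'[of y] r] int_G by simp
  show ?thesis
  proof (rule ccontr)
    \<comment> \<open>Averaging: if every removal from \<open>S\<close> cost more than claimed, the
      losses, at least \<open>card G / 2\<close> in number, would together exceed \<open>?I\<close>,
      against \<open>pointwise\<close>.\<close>
    assume neg: "\<not> ?thesis"
    let ?I = "\<integral>x. ?B x \<partial>P"
    have "?I \<ge> 0" by simp
    have "?I \<le> card S * (2 / card G * ?I)"
    proof -
      have "1 \<le> real (card S) * (2 / card G)" using S card by (simp add: field_simps)
      then show ?thesis using mult_right_mono[OF _ \<open>?I \<ge> 0\<close>] by fastforce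
    qed
    also have "\<dots> = (\<Sum>y\<in>S. 2 / card G * ?I)" by simp
    also have "\<dots> < (\<Sum>y\<in>S. distortion r (G - {y}) - distortion r G)"
      using neg S by (intro sum_strict_mono) (auto simp: not_le subset_iff)
    also have "\<dots> = (\<integral>x. (\<Sum>y\<in>S. ?L y x) \<partial>P)"
      unfolding L using int_L by (subst Bochner_Integration.integral_sum) auto
    also have "\<dots> \<le> ?I" using int_L int_B pointwise by (intro integral_mono) auto
    finally show False by simp
  qed
qed

text \<open>Submodularity: adding \<open>\<xi>\<close> to \<open>G\<close> gains no more than adding it to \<open>G - {y}\<close>, and by optimality
  the latter cannot gain more than the loss caused by removing \<open>y\<close>.\<close>

lemma optimal_gain:
  assumes r: "0 < r" "r \<le> \<rho>" and G: "G \<in> quantizers n"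
    and opt: "\<And>G'. G' \<in> quantizers n \<Longrightarrow> distortion r G \<le> distortion r G'"
    and y: "y \<in> G" "2 \<le> card G"
  shows "distortion r G - distortion r (insert \<xi> G) \<le> distortion r (G - {y}) - distortion r G"
proof -
  have fin: "finite G" "G \<noteq> {}" "card G \<le> n" using G by (auto simp: quantizers_def)
  have fin': "finite (G - {y})" "G - {y} \<noteq> {}"
    using fin Diff_singleton_nonempty[OF y(2)] by auto
  have "card (insert \<xi> (G - {y})) \<le> Suc (card (G - {y}))" using fin by (intro card_insert_le_m1) auto
  then have "insert \<xi> (G - {y}) \<in> quantizers n" using fin y by (auto simp: quantizers_def card_Diff_singleton)
  then have "distortion r G \<le> distortion r (insert \<xi> (G - {y}))" by (rule opt)
  also have "\<dots> - distortion r (insert \<xi> G) = (\<integral>x. gap N (insert \<xi> (G - {y})) x powr r - gap N (insert \<xi> G) x powr r \<partial>P)"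
    unfolding distortion_def using fin fin' r by (simp add: integrable_gap)
  also have "\<dots> \<le> (\<integral>x. gap N (G - {y}) x powr r - gap N G x powr r \<partial>P)"
  proof (rule integral_mono)
    fix x
    have le: "gap N G x \<le> gap N (G - {y}) x" using fin fin' by (intro gap_antimono) auto
    then have "gap N G x powr r \<le> gap N (G - {y}) x powr r" using r fin by (intro powr_mono2 gap_nonneg) auto
    \<comment> \<open>Capping two ordered values at the same level \<open>N (x - \<xi>)\<close> can
      only shrink the difference of their powers.\<close>
    then show "gap N (insert \<xi> (G - {y})) x powr r - gap N (insert \<xi> G) x powr r
        \<le> gap N (G - {y}) x powr r - gap N G x powr r"
      unfolding gap_insert[OF fin(1,2)] gap_insert[OF fin'] using r le
      by (auto simp: min_def not_le intro!: powr_mono2 gap_nonneg fin fin')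
  qed (use fin fin' r in \<open>auto simp: integrable_gap\<close>)
  also have "\<dots> = distortion r (G - {y}) - distortion r G"
    unfolding distortion_def using fin fin' r by (simp add: integrable_gap)
  finally show ?thesis by simp
qed

definition optimal :: "real \<Rightarrow> nat \<Rightarrow> (real^'d) set \<Rightarrow> bool" where
  "optimal r n G \<longleftrightarrow> G \<in> quantizers n \<and> (\<forall>G'\<in>quantizers n. distortion r G \<le> distortion r G')"

text \<open>The factor \<open>1 / n\<close> comes from averaging over the removable points, the
  factor \<open>n powr (- r / d)\<close> from the distortions of a good set of about
  \<open>n / 2\<close> points and of \<open>G\<close> itself.\<close>

lemma optimal_gain_le:
  assumes r: "0 < r" "r < \<rho>"
  shows "\<exists>K>0. \<forall>n\<ge>1. \<forall>G \<xi>. optimal r n G \<longrightarrow>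
    distortion r G - distortion r (insert \<xi> G) \<le> K * real n powr (- 1 - r / CARD('d))"
proof -
  let ?e = "r / CARD('d)"
  obtain C where C: "C > 0" "\<And>n. 1 \<le> n \<Longrightarrow> \<exists>H. finite H \<and> H \<noteq> {} \<and> card H \<le> n \<and>
      distortion r H \<le> C * real n powr (- ?e)"
    using distortion_upper_bound[OF r] by auto
  have e: "0 < ?e" using r by simp
  \<comment> \<open>The factors come in turn from the averaging, from splitting the power of
    \<open>2 * gap N H x + gap N G x\<close>, and from replacing \<open>n\<close> by
    \<open>n div 2\<close>, which is at least \<open>n / 3\<close> once \<open>n\<close> is at least
    2.\<close>
  define K where "K = 2 * (2 powr r * (2 powr r + 1) * (C * 3 powr ?e))"
  have K: "C \<le> K"
  proof -
    have "1 * 1 \<le> 2 powr r * (2 powr r + 1)"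
      using r by (intro mult_mono ge_one_powr_ge_zero) auto
    then have "1 * (1 * (C * 1)) \<le> 2 * (2 powr r * (2 powr r + 1) * (C * 3 powr ?e))"
      using C r e by (intro mult_mono ge_one_powr_ge_zero) auto
    then show ?thesis by (simp add: K_def)
  qed
  have "distortion r G - distortion r (insert \<xi> G) \<le> K * real n powr (- 1 - ?e)"
    if n: "1 \<le> n" and G: "optimal r n G" for n G \<xi>
  proof -
    have fin: "finite G" "G \<noteq> {}" "card G \<le> n" using G by (auto simp: optimal_def quantizers_def)
    have opt: "distortion r G \<le> distortion r G'" if "G' \<in> quantizers n" for G'
      using G that by (auto simp: optimal_def)
    have DG: "distortion r G \<le> C * real n powr (- ?e)"
    proof -
      obtain H where "finite H" "H \<noteq> {}" "card H \<le> n" "distortion r H \<le> C * real n powr (- ?e)"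
        using C(2)[OF n] by blast
      then show ?thesis using opt[of H] by (auto simp: quantizers_def)
    qed
    \<comment> \<open>An optimal set may have fewer than \<open>n\<close> points; then
      \<open>insert \<xi> G\<close> is itself a competitor and nothing is gained. For
      \<open>n = 1\<close> no point can be spared, and the whole distortion bounds the gain.\<close>
    consider "n = 1" | "card G < n" | "2 \<le> n" "card G = n" using n fin by linarith
    then show ?thesis
    proof cases
      case 1
      then have "distortion r G - distortion r (insert \<xi> G) \<le> C"
        using DG distortion_nonneg[of r "insert \<xi> G"] by simp
      with 1 K show ?thesis by simp
    next
      case 2
      then have "insert \<xi> G \<in> quantizers n"
        using fin card_insert_le_m1[of n G \<xi>] by (auto simp: quantizers_def)
      moreover have "0 \<le> K * real n powr (- 1 - ?e)" using K C by simp
      ultimately show ?thesis using opt[of "insert \<xi> G"] by simp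
    next
      case 3
      define m where "m = n div 2"
      have m: "1 \<le> m" "2 * m \<le> n" "n \<le> 3 * m" using 3 by (auto simp: m_def)
      obtain H where H: "finite H" "H \<noteq> {}" "card H \<le> m" "distortion r H \<le> C * real m powr (- ?e)"
        using C(2)[OF m(1)] by blast
      have "real m powr (- ?e) \<le> (real n / 3) powr (- ?e)"
        using m 3 e by (intro powr_mono2') auto
      also have "\<dots> = 3 powr ?e * real n powr (- ?e)"
        by (simp add: powr_divide powr_minus divide_simps)
      finally have m_le: "real m powr (- ?e) \<le> 3 powr ?e * real n powr (- ?e)" .
      define Z where "Z = C * 3 powr ?e * real n powr (- ?e)"
      have DH: "distortion r H \<le> Z"
        using order_trans[OF H(4) mult_left_mono[OF m_le, of C]] C(1) by (simp add: Z_def mult_ac)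
      have "1 \<le> 3 powr ?e" using e by (intro ge_one_powr_ge_zero) auto
      then have "C * real n powr (- ?e) * 1 \<le> C * real n powr (- ?e) * 3 powr ?e"
        using C by (intro mult_left_mono) auto
      then have DG': "distortion r G \<le> Z" using DG by (simp add: Z_def mult_ac)
      obtain y where y: "y \<in> G" "distortion r (G - {y}) - distortion r G
          \<le> 2 / card G * (\<integral>x. (2 * gap N H x + gap N G x) powr r \<partial>P)"
        using cheap_removal[of r G H] r fin H m 3 by auto
      have "(\<integral>x. (2 * gap N H x + gap N G x) powr r \<partial>P)
          \<le> (\<integral>x. 2 powr r * (2 powr r * gap N H x powr r + gap N G x powr r) \<partial>P)"
      proof (rule integral_mono')
        show "integrable P (\<lambda>x. 2 powr r * (2 powr r * gap N H x powr r + gap N G x powr r))"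
          using r H fin by (auto simp: integrable_gap)
        show "(2 * gap N H x + gap N G x) powr r \<le> 2 powr r * (2 powr r * gap N H x powr r + gap N G x powr r)" for x
          using powr_sum_le[of "2 * gap N H x" "gap N G x" r] r gap_nonneg[OF H(1,2), of x] gap_nonneg[OF fin(1,2), of x]
          by (simp add: powr_mult)
      qed simp
      also have "\<dots> = 2 powr r * (2 powr r * distortion r H + distortion r G)"
        unfolding distortion_def using r H fin by (simp add: integrable_gap)
      also have "\<dots> \<le> 2 powr r * (2 powr r * Z + Z)"
        using DH DG' by (intro mult_left_mono add_mono) auto
      finally have "2 / card G * (\<integral>x. (2 * gap N H x + gap N G x) powr r \<partial>P) \<le> 2 / card G * (2 powr r * (2 powr r * Z + Z))"
        by (intro mult_left_mono) auto
      also have "\<dots> = K * (real n powr (- ?e) / real n)"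
        using 3 by (simp add: K_def Z_def algebra_simps)
      also have "real n powr (- ?e) / real n = real n powr (- 1 - ?e)"
        using 3 by (subst diff_conv_add_uminus, subst powr_add) (simp add: powr_minus_divide mult.commute)
      finally have "distortion r (G - {y}) - distortion r G \<le> K * real n powr (- 1 - ?e)"
        using y by simp
      moreover have "distortion r G - distortion r (insert \<xi> G) \<le> distortion r (G - {y}) - distortion r G"
        using r G opt y 3 by (intro optimal_gain[of r G n]) (auto simp: optimal_def)
      ultimately show ?thesis by simp
    qed
  qed
  moreover have "0 < K" using K C by simp
  ultimately show ?thesis by blast
qed

text \<open>Optimality against \<open>{0}\<close>, a competitor for every \<open>n\<close>, bounds
  the gap at the origin uniformly; the Lipschitz property extends this to linear growth.\<close>

lemma optimal_gap_le:
  assumes r: "0 < r" "r \<le> \<rho>"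
  shows "\<exists>L>0. \<forall>n\<ge>1. \<forall>G x. optimal r n G \<longrightarrow> gap N G x \<le> L * max 1 (N x)"
proof -
  define R where "R = (2 powr r * (2 * distortion r {0})) powr (1 / r)"
  have "gap N G x \<le> (R + 1) * max 1 (N x)" if n: "1 \<le> n" and G: "optimal r n G" for n G x
  proof -
    have fin: "finite G" "G \<noteq> {}" using G by (auto simp: optimal_def quantizers_def)
    have D: "distortion r G \<le> distortion r {0}"
      using G n by (auto simp: optimal_def quantizers_def)
    have gap0: "gap N {0} x = N x" for x by (simp add: gap_def)
    have "(\<integral>x. gap N G 0 powr r \<partial>P) \<le> (\<integral>x. 2 powr r * (gap N G x powr r + gap N {0} x powr r) \<partial>P)"
    proof (rule integral_mono)
      fix x
      have "gap N G 0 \<le> gap N G x + N x" using gap_lipschitz[OF fin, of 0 x] by simp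
      then have "gap N G 0 powr r \<le> (gap N G x + N x) powr r"
        using r by (intro powr_mono2 gap_nonneg fin) auto
      also have "\<dots> \<le> 2 powr r * (gap N G x powr r + gap N {0} x powr r)"
        unfolding gap0 using r by (intro powr_sum_le gap_nonneg fin) auto
      finally show "gap N G 0 powr r \<le> 2 powr r * (gap N G x powr r + gap N {0} x powr r)" .
    qed (use r fin in \<open>auto simp: integrable_gap\<close>)
    also have "\<dots> = 2 powr r * (distortion r G + distortion r {0})"
      unfolding distortion_def using r fin by (simp add: integrable_gap)
    also have "\<dots> \<le> 2 powr r * (2 * distortion r {0})"
      using D by (intro mult_left_mono) auto
    finally have "gap N G 0 powr r \<le> 2 powr r * (2 * distortion r {0})" by (simp add: prob_space)
    then have "(gap N G 0 powr r) powr (1 / r) \<le> R"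
      unfolding R_def using r by (intro powr_mono2) auto
    then have "gap N G 0 \<le> R" using r gap_nonneg[OF fin, of 0] by (simp add: powr_powr)
    then have "gap N G x \<le> R + N x" using gap_lipschitz[OF fin, of x 0] by simp
    also have "\<dots> \<le> R * max 1 (N x) + max 1 (N x)"
      using mult_left_mono[of 1 "max 1 (N x)" R] by (simp add: R_def)
    finally show ?thesis by (simp add: distrib_right)
  qed
  moreover have "0 < R + 1" by (simp add: R_def add_nonneg_pos)
  ultimately show ?thesis by blast
qed

text \<open>Within a quarter of the gap around \<open>\<xi>\<close>, every point is at least three
  quarters of that gap away from \<open>G\<close> but at most one quarter away from
  \<open>\<xi>\<close>; elsewhere adding a point does no harm.\<close>

lemma gain_ge:
  assumes r: "0 < r" "r \<le> \<rho>" and G: "finite G" "G \<noteq> {}"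
  shows "((3/4) powr r - (1/4) powr r) * gap N G \<xi> powr r * prob {x. N (x - \<xi>) \<le> gap N G \<xi> / 4}
    \<le> distortion r G - distortion r (insert \<xi> G)"
proof -
  let ?\<kappa> = "(3/4) powr r - (1/4::real) powr r" and ?A = "{x. N (x - \<xi>) \<le> gap N G \<xi> / 4}"
  have A [measurable]: "?A \<in> sets P" unfolding sets_P by measurable
  have "?\<kappa> * gap N G \<xi> powr r * prob ?A = (\<integral>x. ?\<kappa> * gap N G \<xi> powr r * indicator ?A x \<partial>P)"
    using A by simp
  also have "\<dots> \<le> (\<integral>x. gap N G x powr r - gap N (insert \<xi> G) x powr r \<partial>P)"
  proof (rule integral_mono)
    fix x
    show "?\<kappa> * gap N G \<xi> powr r * indicator ?A x \<le> gap N G x powr r - gap N (insert \<xi> G) x powr r"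
    proof (cases "x \<in> ?A")
      case True
      then have x: "N (x - \<xi>) \<le> gap N G \<xi> / 4" by simp
      have "gap N G \<xi> \<le> gap N G x + N (x - \<xi>)"
        using gap_lipschitz[OF G, of \<xi> x] by (simp add: commute)
      with x have "(3/4 * gap N G \<xi>) powr r \<le> gap N G x powr r"
        using r gap_nonneg[OF G, of \<xi>] by (intro powr_mono2) auto
      moreover have "gap N (insert \<xi> G) x powr r \<le> (1/4 * gap N G \<xi>) powr r"
        using r x G by (intro powr_mono2 gap_nonneg) (auto simp: gap_insert)
      moreover have "(3/4 * gap N G \<xi>) powr r = (3/4) powr r * gap N G \<xi> powr r"
        "(1/4 * gap N G \<xi>) powr r = (1/4) powr r * gap N G \<xi> powr r"
        using gap_nonneg[OF G, of \<xi>] by (subst powr_mult; simp)+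
      ultimately show ?thesis using True by (simp add: left_diff_distrib)
    next
      case False
      then show ?thesis using r G by (auto intro!: powr_mono2 gap_nonneg gap_antimono)
    qed
    have "integrable P (indicat_real ?A)"
      by (rule integrable_real_indicator[OF A]) (simp add: less_top[symmetric])
    then show "integrable P (\<lambda>x. ?\<kappa> * gap N G \<xi> powr r * indicator ?A x)"
      by (intro integrable_mult_right)
  qed (use r G in \<open>auto simp: integrable_gap\<close>)
  also have "\<dots> = distortion r G - distortion r (insert \<xi> G)"
    unfolding distortion_def using r G by (simp add: integrable_gap)
  finally show ?thesis .
qed

text \<open>The gain bound is integrated over the added point \<open>\<xi>\<close> with the density
  \<open>max 1 (N \<xi>) powr (- d * a)\<close>, integrable since \<open>a > 1\<close>. After exchanging the integrals, the
  points \<open>\<xi>\<close> within \<open>gap N G x / 5\<close> of \<open>x\<close> contribute the extra factor \<open>gap N G x ^ d\<close>.\<close>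

lemma optimal_energy_le:
  assumes r: "0 < r" "r < \<rho>" and a: "1 < a"
  shows "\<exists>K>0. \<forall>n\<ge>1. \<forall>G. optimal r n G \<longrightarrow>
    (\<integral>\<^sup>+x. gap N G x powr (r + CARD('d)) * max 1 (N x) powr (- real CARD('d) * a) \<partial>P)
      \<le> ennreal (K * real n powr (- 1 - r / CARD('d)))"
proof -
  let ?d = "CARD('d)"
  define w where "w x = max 1 (N x) powr (- real ?d * a)" for x
  have [measurable]: "w \<in> borel_measurable borel" unfolding w_def by measurable
  have w_nonneg: "0 \<le> w x" for x by (simp add: w_def)
  define \<kappa> where "\<kappa> = (3/4) powr r - (1/4::real) powr r"
  have \<kappa>: "0 < \<kappa>" using r by (simp add: \<kappa>_def powr_less_mono2)
  obtain K where K: "K > 0" "\<And>n G \<xi>. 1 \<le> n \<Longrightarrow> optimal r n G \<Longrightarrow>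
      distortion r G - distortion r (insert \<xi> G) \<le> K * real n powr (- 1 - r / ?d)"
    using optimal_gain_le[OF r] by blast
  obtain L where L: "L > 0" "\<And>n G x. 1 \<le> n \<Longrightarrow> optimal r n G \<Longrightarrow> gap N G x \<le> L * max 1 (N x)"
    using optimal_gap_le[of r] r by auto
  obtain cv where cv: "cv > 0" "\<And>x t. 0 \<le> t \<Longrightarrow> ennreal (cv * t ^ ?d) \<le> emeasure lborel {y. N (x - y) \<le> t}"
    using emeasure_ball_ge by blast
  obtain J where J: "0 \<le> J" "(\<integral>\<^sup>+\<xi>. w \<xi> \<partial>lborel) = ennreal J"
    using nn_integral_max_powr[OF a] unfolding w_def by (auto simp: less_top_ennreal)
  \<comment> \<open>Collects the three comparisons made in \<open>lower\<close>: the gap at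
    \<open>\<xi>\<close> with that at \<open>x\<close>, the two weights, and the volume of the ball
    of radius \<open>?g x / 5\<close>.\<close>
  define c where "c = (4/5) powr r * (1 + L) powr (- real ?d * a) * cv / 5 ^ ?d"
  have c: "0 < c" using cv L by (simp add: c_def)
  have "(\<integral>\<^sup>+x. gap N G x powr (r + ?d) * w x \<partial>P) \<le> ennreal ((K / \<kappa> * J / c + 1) * real n powr (- 1 - r / ?d))"
    if n: "1 \<le> n" and G: "optimal r n G" for n G
  proof -
    have fin: "finite G" "G \<noteq> {}" using G by (auto simp: optimal_def quantizers_def)
    note [measurable] = gap_measurable[OF fin]
    note gap_nn = gap_nonneg[OF fin]
    let ?g = "gap N G" and ?B = "K * real n powr (- 1 - r / ?d)"
    have B: "0 \<le> ?B" using K by simp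
    \<comment> \<open>The double integrand: integrating out \<open>x\<close> brings in the gain
      bound at \<open>\<xi>\<close> (\<open>upper\<close>), integrating out \<open>\<xi>\<close>
      produces the energy at \<open>x\<close> (\<open>lower\<close>).\<close>
    define F where "F x \<xi> = ennreal (if N (x - \<xi>) \<le> ?g \<xi> / 4 then ?g \<xi> powr r * w \<xi> else 0)" for x \<xi>
    have F_meas [measurable]: "case_prod F \<in> borel_measurable (P \<Otimes>\<^sub>M lborel)"
      unfolding F_def by measurable
    interpret PL: pair_sigma_finite P lborel ..
    have upper: "(\<integral>\<^sup>+x. F x \<xi> \<partial>P) \<le> ennreal (?B / \<kappa>) * w \<xi>" for \<xi>
    proof -
      let ?A = "{x. N (x - \<xi>) \<le> ?g \<xi> / 4}"
      have A: "?A \<in> sets P" unfolding sets_P by measurable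
      have "(\<integral>\<^sup>+x. F x \<xi> \<partial>P) = (\<integral>\<^sup>+x. ennreal (?g \<xi> powr r * w \<xi>) * indicator ?A x \<partial>P)"
        by (intro nn_integral_cong) (simp add: F_def)
      also have "\<dots> = ennreal (?g \<xi> powr r * prob ?A * w \<xi>)"
        using A w_nonneg by (simp add: nn_integral_cmult_indicator emeasure_eq_measure mult_ac flip: ennreal_mult)
      also have "\<dots> \<le> ennreal (?B / \<kappa> * w \<xi>)"
      proof (intro ennreal_leI mult_right_mono w_nonneg)
        have "\<kappa> * ?g \<xi> powr r * prob ?A \<le> ?B"
          using gain_ge[of r G \<xi>] K(2)[OF n G, of \<xi>] r fin unfolding \<kappa>_def by linarith
        then show "?g \<xi> powr r * prob ?A \<le> ?B / \<kappa>" using \<kappa> by (simp add: field_simps)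
      qed
      also have "\<dots> = ennreal (?B / \<kappa>) * w \<xi>"
        using w_nonneg B \<kappa> by (intro ennreal_mult) auto
      finally show ?thesis .
    qed
    have lower: "ennreal c * ennreal (?g x powr (r + ?d) * w x) \<le> (\<integral>\<^sup>+\<xi>. F x \<xi> \<partial>lborel)" for x
    proof (cases "?g x = 0")
      case False
      then have gx: "0 < ?g x" using gap_nn[of x] by simp
      \<comment> \<open>The radius \<open>?g x / 5\<close> makes \<open>?g \<xi>\<close> at least
        \<open>4/5 * ?g x\<close>, which puts \<open>x\<close> within \<open>?g \<xi> / 4\<close> of
        \<open>\<xi>\<close>.\<close>
      let ?A = "{y. N (x - y) \<le> ?g x / 5}" and ?k = "(4/5) powr r * ?g x powr r * ((1 + L) powr (- real ?d * a) * w x)"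
      have k: "0 \<le> ?k" using w_nonneg by simp
      have F_ge: "ennreal ?k * indicator ?A \<xi> \<le> F x \<xi>" for \<xi>
      proof (cases "\<xi> \<in> ?A")
        case True
        then have \<xi>: "N (x - \<xi>) \<le> ?g x / 5" by simp
        have "?g x \<le> ?g \<xi> + N (x - \<xi>)" by (rule gap_lipschitz[OF fin])
        with \<xi> have g\<xi>: "4/5 * ?g x \<le> ?g \<xi>" by simp
        then have "N (x - \<xi>) \<le> ?g \<xi> / 4" using \<xi> by simp
        moreover have "(4/5) powr r * ?g x powr r \<le> ?g \<xi> powr r"
        proof -
          have "(4/5 * ?g x) powr r \<le> ?g \<xi> powr r" using g\<xi> gx r by (intro powr_mono2) auto
          then show ?thesis using gx by (subst (asm) powr_mult) auto
        qed
        \<comment> \<open>The gap grows at most linearly, so \<open>\<xi>\<close> is at most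
          \<open>1 + L\<close> times as far out as \<open>x\<close>, up to the cutoff at 1.\<close>
        moreover have "(1 + L) powr (- real ?d * a) * w x \<le> w \<xi>"
        proof -
          have "N \<xi> \<le> N x + N (x - \<xi>)" using triangle[of x "\<xi> - x"] by (simp add: commute)
          also have "\<dots> \<le> max 1 (N x) + L * max 1 (N x)"
            using \<xi> L(2)[OF n G, of x] gx by linarith
          finally have "max 1 (N \<xi>) \<le> (1 + L) * max 1 (N x)"
            using L(1) mult_mono[of 1 "1 + L" 1 "max 1 (N x)"] by (simp add: distrib_right)
          then have "((1 + L) * max 1 (N x)) powr (- real ?d * a) \<le> w \<xi>"
            unfolding w_def using a by (intro powr_mono2') auto
          then show ?thesis using L by (simp add: powr_mult w_def)
        qed
        ultimately show ?thesis using True w_nonneg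
          by (auto simp: F_def intro!: ennreal_leI mult_mono)
      qed simp
      have "ennreal c * ennreal (?g x powr (r + ?d) * w x) = ennreal ?k * ennreal (cv * (?g x / 5) ^ ?d)"
        using c gx cv w_nonneg
        by (simp add: c_def powr_add powr_realpow power_divide mult_ac flip: ennreal_mult)
      also have "\<dots> \<le> ennreal ?k * emeasure lborel ?A"
        using gx by (intro mult_left_mono cv) auto
      also have "\<dots> = (\<integral>\<^sup>+\<xi>. ennreal ?k * indicator ?A \<xi> \<partial>lborel)"
        by (subst nn_integral_cmult_indicator) auto
      also have "\<dots> \<le> (\<integral>\<^sup>+\<xi>. F x \<xi> \<partial>lborel)" by (intro nn_integral_mono F_ge)
      finally show ?thesis .
    qed simp
    have "ennreal c * (\<integral>\<^sup>+x. ennreal (?g x powr (r + ?d) * w x) \<partial>P)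
        = (\<integral>\<^sup>+x. ennreal c * ennreal (?g x powr (r + ?d) * w x) \<partial>P)"
      by (subst nn_integral_cmult) auto
    also have "\<dots> \<le> (\<integral>\<^sup>+x. \<integral>\<^sup>+\<xi>. F x \<xi> \<partial>lborel \<partial>P)" by (intro nn_integral_mono lower)
    also have "\<dots> = (\<integral>\<^sup>+\<xi>. \<integral>\<^sup>+x. F x \<xi> \<partial>P \<partial>lborel)" by (rule PL.Fubini'[symmetric]) measurable
    also have "\<dots> \<le> (\<integral>\<^sup>+\<xi>. ennreal (?B / \<kappa>) * w \<xi> \<partial>lborel)" by (intro nn_integral_mono upper)
    also have "\<dots> = ennreal (?B / \<kappa>) * (\<integral>\<^sup>+\<xi>. w \<xi> \<partial>lborel)" by (rule nn_integral_cmult) simp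
    also have "\<dots> = ennreal (?B / \<kappa> * J)" unfolding J(2) using J(1) B \<kappa> by (intro ennreal_mult[symmetric]) auto
    also have "\<dots> = ennreal c * ennreal (K / \<kappa> * J / c * real n powr (- 1 - r / ?d))"
      using c J B \<kappa> K by (simp flip: ennreal_mult)
    finally have "(\<integral>\<^sup>+x. ennreal (?g x powr (r + ?d) * w x) \<partial>P) \<le> ennreal (K / \<kappa> * J / c * real n powr (- 1 - r / ?d))"
      using c by (subst (asm) ennreal_mult_le_mult_iff) auto
    \<comment> \<open>Adding 1 makes the constant positive, as \<open>J\<close> is only recorded as
      nonnegative.\<close>
    also have "\<dots> \<le> ennreal ((K / \<kappa> * J / c + 1) * real n powr (- 1 - r / ?d))"
      by (intro ennreal_leI mult_right_mono) auto
    finally show ?thesis .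
  qed
  moreover have "0 < K / \<kappa> * J / c + 1" using K \<kappa> J c by (simp add: add_nonneg_pos)
  ultimately show ?thesis unfolding w_def by blast
qed

text \<open>The exponents \<open>s / (d + r)\<close>, \<open>\<beta>\<close> and \<open>d s / ((d + r) \<rho>')\<close> sum to one; with \<open>a = \<rho> / \<rho>'\<close> the powers of
  \<open>max 1 (N x)\<close> in the three Hoelder factors cancel.\<close>

lemma optimal_mismatch:
  fixes r s \<rho>' :: real
  assumes r: "0 < r" "r < \<rho>" and s: "0 < s" "s < CARD('d) + r"
    and \<rho>': "s * CARD('d) / (CARD('d) + r - s) < \<rho>'" "\<rho>' < \<rho>"
  defines "\<beta> \<equiv> (CARD('d) + r - s) / (CARD('d) + r) - CARD('d) * s / ((CARD('d) + r) * \<rho>')"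
  shows "\<exists>K>0. \<forall>n\<ge>1. \<forall>G h V. optimal r n G \<longrightarrow> h \<in> borel_measurable borel \<longrightarrow> (\<forall>x. 0 \<le> h x) \<longrightarrow> 0 < V \<longrightarrow>
    (\<integral>\<^sup>+x. h x powr (1 / \<beta>) \<partial>P) \<le> ennreal V \<longrightarrow>
    (\<integral>\<^sup>+x. gap N G x powr s * h x \<partial>P) \<le> ennreal (K * real n powr (- s / CARD('d)) * V powr \<beta>)"
proof -
  define d where "d = real CARD('d)"
  have d: "0 < d" by (simp add: d_def)
  have dr: "0 < d + r" "0 < d + r - s" using d r s by (auto simp: d_def)
  have \<rho>'_pos: "0 < \<rho>'" using \<rho>'(1) s dr d
    by (smt (verit) d_def divide_pos_pos mult_pos_pos)
  \<comment> \<open>Above 1 because \<open>\<rho>' < \<rho>\<close>, as the integrability of the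
    weight in \<open>optimal_energy_le\<close> requires.\<close>
  define a where "a = \<rho> / \<rho>'"
  have a: "1 < a" using \<rho>' \<rho>'_pos by (simp add: a_def)
  define \<alpha> where "\<alpha> = s / (d + r)"
  define \<gamma> where "\<gamma> = d * s / ((d + r) * \<rho>')"
  have \<beta>_eq: "\<beta> = (d + r - s) / (d + r) - \<gamma>" by (simp add: \<beta>_def \<gamma>_def d_def)
  have sum1: "\<alpha> + \<beta> + \<gamma> = 1" using dr by (simp add: \<alpha>_def \<beta>_eq flip: add_divide_distrib)
  \<comment> \<open>Positivity is a rearrangement of the lower bound on
    \<open>\<rho>'\<close>.\<close>
  have \<beta>: "0 < \<beta>"
  proof -
    have "d * s < \<rho>' * (d + r - s)" using \<rho>'(1) dr by (simp add: d_def field_simps)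
    then have "d * s / \<rho>' < d + r - s" using \<rho>'_pos by (simp add: pos_divide_less_eq mult.commute)
    then have "d * s / \<rho>' / (d + r) < (d + r - s) / (d + r)" using dr by (intro divide_strict_right_mono)
    moreover have "d * s / \<rho>' / (d + r) = \<gamma>" by (simp add: \<gamma>_def mult.commute)
    ultimately have "\<gamma> < (d + r - s) / (d + r)" by simp
    then show ?thesis by (simp add: \<beta>_eq)
  qed
  have \<alpha>: "0 < \<alpha>" and \<gamma>: "0 < \<gamma>" using s dr d \<rho>'_pos by (auto simp: \<alpha>_def \<gamma>_def)
  have exps: "\<rho> * \<gamma> = d * a * \<alpha>" by (simp add: \<gamma>_def a_def \<alpha>_def mult_ac)
  obtain K where K: "K > 0" "\<And>n G. 1 \<le> n \<Longrightarrow> optimal r n G \<Longrightarrow>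
      (\<integral>\<^sup>+x. gap N G x powr (r + d) * max 1 (N x) powr (- d * a) \<partial>P) \<le> ennreal (K * real n powr (- 1 - r / d))"
    using optimal_energy_le[OF r a] unfolding d_def by blast
  define W where "W = (\<integral>x. max 1 (N x) powr \<rho> \<partial>P)"
  have W: "0 < W"
  proof -
    have "(\<integral>x. 1 \<partial>P) \<le> W" unfolding W_def
      using \<rho>_pos by (intro integral_mono integrable_max ge_one_powr_ge_zero) auto
    then show ?thesis by (simp add: prob_space)
  qed
  have W_eq: "(\<integral>\<^sup>+x. max 1 (N x) powr \<rho> \<partial>P) = ennreal W"
    unfolding W_def by (intro nn_integral_eq_integral integrable_max) auto
  have "(\<integral>\<^sup>+x. gap N G x powr s * h x \<partial>P) \<le> ennreal (K powr \<alpha> * W powr \<gamma> * real n powr (- s / d) * V powr \<beta>)"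
    if n: "1 \<le> n" and G: "optimal r n G" and h [measurable]: "h \<in> borel_measurable borel" and h_nn: "\<And>x. 0 \<le> h x"
      and V: "0 < V" "(\<integral>\<^sup>+x. h x powr (1 / \<beta>) \<partial>P) \<le> ennreal V" for n G h V
  proof -
    have fin: "finite G" "G \<noteq> {}" using G by (auto simp: optimal_def quantizers_def)
    note [measurable] = gap_measurable[OF fin]
    have "(\<integral>\<^sup>+x. gap N G x powr s * h x \<partial>P) =
        (\<integral>\<^sup>+x. (gap N G x powr (r + d) * max 1 (N x) powr (- d * a)) powr \<alpha> * (h x powr (1 / \<beta>)) powr \<beta>
          * (max 1 (N x) powr \<rho>) powr \<gamma> \<partial>P)"
    proof (intro nn_integral_cong arg_cong[where f = ennreal])
      fix x
      have "(r + d) * \<alpha> = s" using dr by (simp add: \<alpha>_def add.commute)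
      then have "(gap N G x powr (r + d) * max 1 (N x) powr (- d * a)) powr \<alpha> * (h x powr (1 / \<beta>)) powr \<beta>
          * (max 1 (N x) powr \<rho>) powr \<gamma>
          = gap N G x powr s * h x * (max 1 (N x) powr (- d * a * \<alpha>) * max 1 (N x) powr (\<rho> * \<gamma>))"
        using \<beta> h_nn by (simp add: powr_mult powr_powr mult_ac)
      also have "max 1 (N x) powr (- d * a * \<alpha>) * max 1 (N x) powr (\<rho> * \<gamma>) = 1"
        by (simp add: exps flip: powr_add)
      finally show "gap N G x powr s * h x = (gap N G x powr (r + d) * max 1 (N x) powr (- d * a)) powr \<alpha> * (h x powr (1 / \<beta>)) powr \<beta>
          * (max 1 (N x) powr \<rho>) powr \<gamma>" by simp
    qed
    also have "\<dots> \<le> ennreal ((K * real n powr (- 1 - r / d)) powr \<alpha> * V powr \<beta> * W powr \<gamma>)"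
      using \<alpha> \<beta> \<gamma> sum1 K n G V W W_eq by (intro nn_integral_Hoelder3) auto
    also have "(K * real n powr (- 1 - r / d)) powr \<alpha> = K powr \<alpha> * real n powr (- s / d)"
    proof -
      have "- 1 - r / d = - ((d + r) / d)" using d by (simp add: add_divide_distrib)
      then have "(- 1 - r / d) * \<alpha> = - s / d" using dr by (simp add: \<alpha>_def)
      then show ?thesis by (simp add: powr_mult powr_powr)
    qed
    finally show ?thesis by (simp add: mult_ac)
  qed
  moreover have "0 < K powr \<alpha> * W powr \<gamma>" using K W by simp
  ultimately show ?thesis unfolding d_def by blast
qed

text \<open>The mean of \<open>N (x - y) powr \<rho>\<close> over independent \<open>x\<close> and
  \<open>y\<close> is positive when there are no atoms, and by the triangle inequality it is at most
  \<open>2 powr \<rho> * 2\<close> times the moment about any \<open>b\<close>. This bounds the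
  infimum away from 0.\<close>

lemma sigma_moment_pos:
  assumes no_atoms: "\<And>x. emeasure P {x} = 0"
  shows "0 < sigma_moment N \<rho> P"
proof -
  define c where "c = (\<integral>\<^sup>+x. \<integral>\<^sup>+y. N (x - y) powr \<rho> \<partial>P \<partial>P)"
  have "c \<noteq> 0"
  proof
    assume "c = 0"
    \<comment> \<open>A vanishing inner integral at one \<open>x\<close> would make \<open>P\<close>
      the point mass at that \<open>x\<close>.\<close>
    then have "AE x in P. (\<integral>\<^sup>+y. N (x - y) powr \<rho> \<partial>P) = 0"
      unfolding c_def by (subst (asm) nn_integral_0_iff_AE) (auto intro!: borel_measurable_nn_integral)
    then obtain x where "(\<integral>\<^sup>+y. N (x - y) powr \<rho> \<partial>P) = 0"
      using AE_contr by (metis (mono_tags, lifting) AE_mp AE_I2)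
    then have "AE y in P. y = x"
      by (subst (asm) nn_integral_0_iff_AE) (auto simp: powr_eq_0_iff elim!: eventually_mono)
    moreover have "AE y in P. y \<noteq> x"
      using no_atoms[of x] by (intro AE_I[of _ _ "{x}"]) (auto simp: sets_P)
    ultimately have "AE y in P. False" by eventually_elim simp
    then show False by simp
  qed
  have int: "integrable P (\<lambda>x. N (x - b) powr \<rho>)" for b
    using integrable_gap[of "{b}" \<rho>] \<rho>_pos by (simp add: gap_def)
  let ?m = "\<lambda>b. \<integral>x. N (x - b) powr \<rho> \<partial>P"
  have nn_m: "(\<integral>\<^sup>+x. N (x - b) powr \<rho> \<partial>P) = ennreal (?m b)" for b
    by (intro nn_integral_eq_integral int) simp
  have c_le: "c \<le> ennreal (2 powr \<rho> * (2 * ?m b))" for b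
  proof -
    have "c \<le> (\<integral>\<^sup>+x. \<integral>\<^sup>+y. ennreal (2 powr \<rho>) * (ennreal (N (x - b) powr \<rho>) + ennreal (N (y - b) powr \<rho>)) \<partial>P \<partial>P)"
      unfolding c_def
    proof (intro nn_integral_mono)
      fix x y
      have "N (x - y) powr \<rho> \<le> (N (x - b) + N (y - b)) powr \<rho>"
        using triangle_diff[of x y b] \<rho>_pos by (intro powr_mono2) (auto simp: commute)
      also have "\<dots> \<le> 2 powr \<rho> * (N (x - b) powr \<rho> + N (y - b) powr \<rho>)"
        using \<rho>_pos by (intro powr_sum_le) auto
      finally show "ennreal (N (x - y) powr \<rho>) \<le> ennreal (2 powr \<rho>) * (ennreal (N (x - b) powr \<rho>) + ennreal (N (y - b) powr \<rho>))"
        by (simp flip: ennreal_mult ennreal_plus)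
    qed
    also have "\<dots> = ennreal (2 powr \<rho>) * (ennreal (?m b) + ennreal (?m b))"
      by (simp add: nn_integral_cmult nn_integral_add nn_m emeasure_space_1)
    finally show ?thesis by (simp flip: ennreal_mult ennreal_plus)
  qed
  then obtain c' where c': "c = ennreal c'" "0 \<le> c'"
    using c_le[of 0] by (cases c) (auto simp: top_unique)
  with \<open>c \<noteq> 0\<close> have "0 < c'" by (cases "c' = 0") auto
  have "c' \<le> 2 powr \<rho> * (2 * ?m b)" for b
    using c_le[of b] unfolding c' by (subst (asm) ennreal_le_iff) auto
  then have "c' / (2 powr \<rho> * 2) \<le> ?m b" for b by (simp add: field_simps)
  then have "(c' / (2 powr \<rho> * 2)) powr (1 / \<rho>) \<le> sigma_moment N \<rho> P"
    unfolding sigma_moment_def using \<rho>_pos \<open>0 < c'\<close> by (intro cINF_greatest powr_mono2) auto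
  moreover have "0 < (c' / (2 powr \<rho> * 2)) powr (1 / \<rho>)" using \<open>0 < c'\<close> by simp
  ultimately show ?thesis by linarith
qed

end

subsection \<open>Dilated quantizers\<close>

lemma (in norm_on) quant_error_eq:
  assumes "finite G" "G \<noteq> {}" "0 < p"
  shows "quant_error N p G P = (\<integral>x. gap N G x powr p \<partial>P) powr (1 / p)"
  unfolding quant_error_def Min_powr[OF assms] ..

lemma (in norm_on) gap_dilation:
  assumes G: "finite G" "G \<noteq> {}" and \<theta>: "0 < \<theta>"
  shows "gap N (dilation \<theta> \<mu> ` G) (dilation \<theta> \<mu> x) = \<theta> * gap N G x"
proof -
  have "N (dilation \<theta> \<mu> x - dilation \<theta> \<mu> y) = \<theta> * N (x - y)" for y
    using \<theta> scale[of \<theta> "x - y"] by (simp add: dilation_def algebra_simps)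
  then have "gap N (dilation \<theta> \<mu> ` G) (dilation \<theta> \<mu> x) = Min ((\<lambda>y. \<theta> * N (x - y)) ` G)"
    by (simp add: gap_def image_image)
  also have "\<dots> = Min ((*) \<theta> ` (\<lambda>y. N (x - y)) ` G)" by (simp add: image_image)
  also have "\<dots> = \<theta> * gap N G x"
    unfolding gap_def using G \<theta> by (intro mono_Min_commute[symmetric]) (auto intro!: monoI)
  finally show ?thesis .
qed

lemma nn_integral_dilation:
  fixes g :: "real^'d \<Rightarrow> ennreal"
  assumes [measurable]: "g \<in> borel_measurable borel" and \<theta>: "0 < \<theta>"
  shows "(\<integral>\<^sup>+x. g x \<partial>lborel) = ennreal (\<theta> ^ CARD('d)) * (\<integral>\<^sup>+x. g (dilation \<theta> \<mu> x) \<partial>lborel)"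
proof -
  have dil: "dilation \<theta> \<mu> = (\<lambda>x. (\<mu> - \<theta> *\<^sub>R \<mu>) + \<theta> *\<^sub>R x)"
    by (auto simp: dilation_def algebra_simps)
  show ?thesis unfolding dil using \<theta>
    by (subst lborel_affine[of \<theta> "\<mu> - \<theta> *\<^sub>R \<mu>"]) (simp_all add: nn_integral_density nn_integral_distr nn_integral_cmult)
qed

lemma dilation_measurable [measurable]: "dilation \<theta> \<mu> \<in> borel_measurable borel"
  unfolding dilation_def by measurable

section \<open>Positivity of the factors of \<open>kappa\<close>\<close>

lemma min_phi_pos:
  assumes r: "0 < r" and d: "1 \<le> d"
  shows "0 < min_phi r d"
proof -
  \<comment> \<open>An infimum of positive numbers might vanish; being attained, this one does
    not.\<close>
  obtain \<epsilon> where \<epsilon>: "\<epsilon> \<in> {0<..<1/3}" "min_phi r d = (1 + \<epsilon>) * phi r d \<epsilon> powr (- 1 / (real d + r))"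
    using min_phi_attained[OF assms] by blast
  have "\<epsilon> powr r < (1/3) powr r" using \<epsilon>(1) r by (intro powr_less_mono2) auto
  then have "0 < phi r d \<epsilon>" using \<epsilon>(1) by (simp add: phi_def powr_divide)
  with \<epsilon> show ?thesis by simp
qed

text \<open>All remaining factors are positive, so the equation can be solved for the second
  constant with the first set to 0.\<close>

lemma (in norm_on) kappa_large:
  fixes K :: real
  assumes "0 < r" "0 < r + \<delta> - \<eta>" "0 < \<eta>" "0 \<le> K"
  shows "\<exists>C. 0 \<le> C \<and> kappa N r \<delta> \<eta> q p' 0 C = K"
proof -
  let ?d = "real CARD('d)" and ?a = "(r + \<delta>) / (r + \<delta> - \<eta>)"
  let ?J = "\<integral>x. max 1 (N x) powr (- ?d * ?a) \<partial>lborel" and ?V = "unit_ball_volume N"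
  have a: "1 < ?a" using assms by simp
  \<comment> \<open>Integrability matters: otherwise the Bochner integral would be 0 by convention,
    and \<open>kappa\<close> with it.\<close>
  have int: "integrable lborel (\<lambda>x. max 1 (N x) powr (- ?d * ?a))"
    using nn_integral_max_powr[OF a] by (intro integrableI_nonneg) auto
  have "?J \<noteq> 0"
  proof
    assume "?J = 0"
    then have "AE x in lborel. max 1 (N x) powr (- ?d * ?a) = 0"
      using integral_nonneg_eq_0_iff_AE[OF int] by simp
    then have "AE x in (lborel :: (real^'d) measure). False" by (rule eventually_mono) (simp add: max_def split: if_splits)
    then show False by (simp add: eventually_False ae_filter_eq_bot_iff)
  qed
  moreover have "0 \<le> ?J" by simp
  ultimately have J: "0 < ?J" by linarith
  define A where "A = 2 powr ((2 * q * p' - 1) / (q * p' * (?d + r))) * min_phi r CARD('d) * ?J powr (1 / (?d + r))"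
  have A: "0 < A" using J min_phi_pos[OF assms(1), of "CARD('d)"] by (simp add: A_def Suc_le_eq)
  \<comment> \<open>Solves \<open>2 powr r * C powr r / ?V = (K / A) powr (?d + r)\<close>.\<close>
  define C where "C = (?V * (K / A) powr (?d + r)) powr (1 / r) / 2"
  have dr: "0 < ?d + r" using assms by (simp add: add_nonneg_pos)
  have "2 powr r * C powr r = (2 * C) powr r"
    by (rule powr_mult[symmetric])
  also have "\<dots> = ?V * (K / A) powr (?d + r)"
    using unit_ball_volume_pos assms by (simp add: C_def powr_powr)
  finally have "(((2 powr r - 1) * 0 powr r + 2 powr r * C powr r) / ?V) powr (1 / (?d + r)) = K / A"
    using unit_ball_volume_pos dr A assms by (simp add: powr_powr)
  then have "kappa N r \<delta> \<eta> q p' 0 C = A * (K / A)"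
    unfolding kappa_def Let_def A_def by simp
  then have "kappa N r \<delta> \<eta> q p' 0 C = K" using A by simp
  moreover have "0 \<le> C" by (simp add: C_def)
  ultimately show ?thesis by blast
qed

theorem theorem4p1:
  fixes N :: "real^'d \<Rightarrow> real"
    and M :: "'w measure"
    and X :: "'w \<Rightarrow> real^'d"
    and f :: "real^'d \<Rightarrow> real"
    and P :: "(real^'d) measure"
    and \<Gamma> :: "nat \<Rightarrow> (real^'d) set"
    and d :: nat
    and r s q \<delta> \<eta> p' q' :: real
  assumes d: "d = CARD('d)"
    and N: "is_norm N"
    and r: "0 < r"
    and s: "r \<le> s" "s < d + r"
    and q: "1 - q = (d + r) / (d + r - s)"
    and M: "prob_space M"
    and f_nonneg: "\<And>x. 0 \<le> f x"
    and X: "distributed M lborel X (\<lambda>x. ennreal (f x))"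
    and P: "P = distr M borel X"
    and \<delta>: "0 < \<delta>" "s * d / (d + r - s) < r + \<delta>"
    and moment: "integrable M (\<lambda>\<omega>. N (X \<omega>) powr (r + \<delta>))"
    and \<eta>: "0 < \<eta>" "\<eta> < r + \<delta> - s * d / (d + r - s)"
    and p': "p' = (r + \<delta> - \<eta>) / (d * \<bar>q\<bar>)"
    and q': "q' = (r + \<delta> - \<eta>) / (r + \<delta> - \<eta> - d * \<bar>q\<bar>)"
    and \<Gamma>: "optimal_quantizers N r P \<Gamma>"
  shows "\<exists>C\<^sub>1 C\<^sub>2 :: real. 0 \<le> C\<^sub>1 \<and> 0 \<le> C\<^sub>2 \<and>
    (\<forall>\<theta> \<mu>. 0 < \<theta> \<longrightarrow> admissible f \<theta> \<mu> \<longrightarrow>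
       set_integrable lborel {x. f x > 0} (ratio_integrand f ((1 - q) * q') \<theta> \<mu>) \<longrightarrow>
       (\<forall>n\<ge>1. quant_error N s (dilation \<theta> \<mu> ` \<Gamma> n) P
          \<le> kappa N r \<delta> \<eta> q p' C\<^sub>1 C\<^sub>2 * \<theta> powr (1 + d / s) * sigma_moment N (r + \<delta>) P *
            (LINT x:{x. f x > 0}|lborel. ratio_integrand f ((1 - q) * q') \<theta> \<mu> x)
              powr (1 / (\<bar>q\<bar> * q' * (d + r))) *
            real n powr (- 1 / d)))"
proof -
  define \<rho> where "\<rho> = r + \<delta>"
  define \<rho>' where "\<rho>' = r + \<delta> - \<eta>"
  have d_pos: "0 < real d" by (simp add: d)
  have dr: "0 < d + r" "0 < d + r - s" using d_pos r s by auto
  have s_pos: "0 < s" using r s by simp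
  have \<rho>: "0 < \<rho>" "r < \<rho>" using r \<delta> by (auto simp: \<rho>_def)
  have \<rho>': "s * d / (d + r - s) < \<rho>'" "\<rho>' < \<rho>" using \<eta> by (auto simp: \<rho>_def \<rho>'_def)
  have "0 < s * d / (d + r - s)" using s_pos d_pos dr by simp
  then have \<rho>'_pos: "0 < \<rho>'" using \<rho>'(1) by linarith
  interpret MM: prob_space M by (rule M)
  interpret norm_on N by unfold_locales (rule N)
  have X_meas [measurable]: "X \<in> borel_measurable M" using distributed_measurable[OF X] by simp
  have f_meas [measurable]: "f \<in> borel_measurable borel"
    using distributed_borel_measurable[OF X] f_nonneg by (subst (asm) borel_measurable_ennreal_iff) auto
  have P_density: "P = density lborel (\<lambda>x. ennreal (f x))"
    using distributed_distr_eq_density[OF X] unfolding P by (metis distr_cong sets_lborel)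
  interpret P: prob_space P unfolding P by (rule MM.prob_space_distr) simp
  interpret moment_space N P \<rho>
  proof unfold_locales
    show "integrable P (\<lambda>x. N x powr \<rho>)"
      unfolding P using moment by (subst integrable_distr_eq) (auto simp: \<rho>_def)
  qed (use \<rho> in \<open>auto simp: P\<close>)
  have nn_P: "(\<integral>\<^sup>+x. ennreal (g x) \<partial>P) = (\<integral>\<^sup>+x. ennreal (f x * g x) \<partial>lborel)"
    if "g \<in> borel_measurable borel" for g
    unfolding P_density using that f_nonneg by (subst nn_integral_density) (auto simp: ennreal_mult')
  have no_atoms: "emeasure P {x} = 0" for x
    unfolding P_density by (rule absolutely_continuousD) (auto intro: absolutely_continuousI_density)
  have sigma: "0 < sigma_moment N \<rho> P" by (rule sigma_moment_pos[OF no_atoms])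

  have \<Gamma>_quant: "\<Gamma> n \<in> quantizers n" if "1 \<le> n" for n
    using \<Gamma> that by (auto simp: optimal_quantizers_def)
  \<comment> \<open>The errors are bounded below by 0, so their infimum lies below each of them; the
    root is strictly increasing and can be removed.\<close>
  have \<Gamma>_opt: "optimal r n (\<Gamma> n)" if n: "1 \<le> n" for n
    unfolding optimal_def
  proof (intro conjI ballI \<Gamma>_quant n)
    fix G :: "(real^'d) set" assume G: "G \<in> quantizers n"
    have "quant_error N r (\<Gamma> n) P = (INF G\<in>quantizers n. quant_error N r G P)"
      using \<Gamma> n by (auto simp: optimal_quantizers_def)
    also have "\<dots> \<le> quant_error N r G P"
      using G by (intro cINF_lower bdd_belowI2[of _ 0]) (auto simp: quant_error_def)
    finally have "distortion r (\<Gamma> n) powr (1 / r) \<le> distortion r G powr (1 / r)"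
      using G \<Gamma>_quant[OF n] r by (simp add: quant_error_eq distortion_def quantizers_def)
    then show "distortion r (\<Gamma> n) \<le> distortion r G"
      using powr_less_mono2[of "1 / r" "distortion r G" "distortion r (\<Gamma> n)"] r distortion_nonneg
      by (meson not_le zero_less_divide_1_iff)
  qed

  \<comment> \<open>The Hoelder exponent of the density ratio; \<open>\<beta>_eq\<close> and
    \<open>\<beta>_exp\<close> identify it with the exponents stated through \<open>q\<close> and
    \<open>q'\<close>.\<close>
  define \<beta> where "\<beta> = (CARD('d) + r - s) / (CARD('d) + r) - CARD('d) * s / ((CARD('d) + r) * \<rho>')"
  have q_abs: "\<bar>q\<bar> = s / (d + r - s)"
  proof -
    have "q = - (s / (d + r - s))" using q dr by (simp add: field_simps)
    then show ?thesis using s_pos dr by simp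
  qed
  have \<beta>_eq: "\<beta> = 1 / ((1 - q) * q')"
  proof -
    have "1 / ((1 - q) * q') = (d + r - s) / (d + r) * ((\<rho>' - d * \<bar>q\<bar>) / \<rho>')"
      by (simp add: q q' \<rho>'_def)
    also have "\<dots> = (d + r - s) / (d + r) * (1 - d * (s / (d + r - s)) / \<rho>')"
      using \<rho>'_pos by (simp add: q_abs diff_divide_distrib)
    also have "\<dots> = (d + r - s) / (d + r) - d * s / ((d + r) * \<rho>')"
    proof -
      have "e / B * (1 - D * (s / e) / \<rho>') = e / B - D * s / (B * \<rho>')" if "e \<noteq> 0" for e B D :: real
        using that by (simp add: right_diff_distrib mult_ac)
      then show ?thesis using dr by simp
    qed
    finally show ?thesis by (simp add: \<beta>_def d)
  qed
  have \<beta>_exp: "\<beta> / s = 1 / (\<bar>q\<bar> * q' * (d + r))"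
  proof -
    have "\<bar>q\<bar> * (d + r) = s * (1 - q)" by (simp add: q_abs q)
    then have "\<bar>q\<bar> * q' * (d + r) = s * ((1 - q) * q')" by (metis mult.assoc mult.commute)
    then show ?thesis unfolding \<beta>_eq divide_divide_eq_left by (metis mult.commute)
  qed
  obtain K where K: "K > 0" "\<And>n G h V. 1 \<le> n \<Longrightarrow> optimal r n G \<Longrightarrow> h \<in> borel_measurable borel \<Longrightarrow> (\<And>x. 0 \<le> h x) \<Longrightarrow> 0 < V \<Longrightarrow>
    (\<integral>\<^sup>+x. h x powr (1 / \<beta>) \<partial>P) \<le> ennreal V \<Longrightarrow>
    (\<integral>\<^sup>+x. gap N G x powr s * h x \<partial>P) \<le> ennreal (K * real n powr (- s / d) * V powr \<beta>)"
    using optimal_mismatch[OF r \<rho>(2) s_pos _ _ \<rho>'(2)] s \<rho>'(1) unfolding \<beta>_def d by blast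
  \<comment> \<open>Chosen so that \<open>kappa\<close> times \<open>sigma_moment\<close> is exactly
    \<open>K powr (1 / s)\<close>; neither \<open>K\<close> nor \<open>C\<close> depends on
    \<open>n\<close>, \<open>\<theta>\<close> or \<open>\<mu>\<close>.\<close>
  obtain C where C: "0 \<le> C" "kappa N r \<delta> \<eta> q p' 0 C = K powr (1 / s) / sigma_moment N \<rho> P"
    using kappa_large[of r \<delta> \<eta> "K powr (1 / s) / sigma_moment N \<rho> P" q p'] r \<rho>'_pos \<eta> sigma
    by (auto simp: \<rho>'_def)
  show ?thesis
  proof (rule exI[of _ 0], rule exI[of _ C], intro conjI allI impI C)
    fix \<theta> :: real and \<mu> :: "real^'d" and n :: nat
    assume \<theta>: "0 < \<theta>" and adm: "admissible f \<theta> \<mu>" and n: "1 \<le> n"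
      and int: "set_integrable lborel {x. f x > 0} (ratio_integrand f ((1 - q) * q') \<theta> \<mu>)"
    let ?T = "dilation \<theta> \<mu>"
    define I where "I = (LINT x:{x. f x > 0}|lborel. ratio_integrand f ((1 - q) * q') \<theta> \<mu> x)"
    \<comment> \<open>Where \<open>f\<close> vanishes the quotient is 0 by the convention on
      division, and admissibility makes \<open>fh\<close> true almost everywhere there.\<close>
    define h where "h x = f (?T x) / f x" for x
    have [measurable]: "h \<in> borel_measurable borel" unfolding h_def by measurable
    have h_nn: "0 \<le> h x" for x using f_nonneg by (simp add: h_def)
    have fh: "AE x in lborel. f (?T x) = f x * h x"
      using adm unfolding admissible_def by eventually_elim (auto simp: h_def)
    have ratio: "indicator {x. f x > 0} x * ratio_integrand f ((1 - q) * q') \<theta> \<mu> x = f x * h x powr (1 / \<beta>)" for x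
      using f_nonneg[of x] by (auto simp: ratio_integrand_def h_def \<beta>_eq indicator_def)
    have I_eq: "(\<integral>\<^sup>+x. h x powr (1 / \<beta>) \<partial>P) = ennreal I"
    proof -
      have "(\<integral>\<^sup>+x. h x powr (1 / \<beta>) \<partial>P) = (\<integral>\<^sup>+x. f x * h x powr (1 / \<beta>) \<partial>lborel)"
        by (rule nn_P) measurable
      also have "\<dots> = ennreal (\<integral>x. f x * h x powr (1 / \<beta>) \<partial>lborel)"
        using int f_nonneg unfolding set_integrable_def
        by (intro nn_integral_eq_integral) (simp_all add: ratio)
      finally show ?thesis by (simp add: I_def set_lebesgue_integral_def ratio)
    qed
    have "0 \<le> I" unfolding I_def set_lebesgue_integral_def using f_nonneg by (simp add: ratio)
    \<comment> \<open>The mismatch bound takes a positive \<open>V\<close>. If \<open>I\<close> were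
      0, \<open>f\<close> composed with the dilation would vanish almost everywhere, against total
      mass one.\<close>
    moreover have "I \<noteq> 0"
    proof
      assume "I = 0"
      then have "(\<integral>\<^sup>+x. h x powr (1 / \<beta>) \<partial>P) = 0" using I_eq by simp
      then have "AE x in P. h x powr (1 / \<beta>) = 0"
        by (subst (asm) nn_integral_0_iff_AE) auto
      then have "AE x in lborel. f x * h x = 0"
        unfolding P_density by (subst (asm) AE_density) (auto elim!: eventually_mono simp: f_nonneg less_le)
      with fh have "AE x in lborel. f (?T x) = 0" by eventually_elim simp
      then have "(\<integral>\<^sup>+x. f (?T x) \<partial>lborel) = 0" by (subst nn_integral_0_iff_AE) auto
      then have "(\<integral>\<^sup>+x. f x \<partial>lborel) = 0"
        by (subst nn_integral_dilation[OF _ \<theta>, of _ \<mu>]) auto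
      moreover have "(\<integral>\<^sup>+x. f x \<partial>lborel) = 1"
        using P.emeasure_space_1 unfolding P_density by (simp add: emeasure_density)
      ultimately show False by simp
    qed
    ultimately have I: "0 < I" by simp
    have G: "finite (\<Gamma> n)" "\<Gamma> n \<noteq> {}" using \<Gamma>_quant[OF n] by (auto simp: quantizers_def)
    have TG: "finite (?T ` \<Gamma> n)" "?T ` \<Gamma> n \<noteq> {}" using G by auto
    note [measurable] = gap_measurable[OF G] gap_measurable[OF TG]
    have "(\<integral>\<^sup>+x. gap N (?T ` \<Gamma> n) x powr s \<partial>P) = (\<integral>\<^sup>+x. f x * gap N (?T ` \<Gamma> n) x powr s \<partial>lborel)"
      by (rule nn_P) measurable
    \<comment> \<open>The substitution moves the dilation from the quantizer to the density: the gap
      becomes \<open>\<theta>\<close> times that of \<open>\<Gamma> n\<close>, and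
      \<open>f (?T x)\<close> becomes \<open>f x * h x\<close>, so the integral is again one against
      \<open>P\<close>.\<close>
    also have "\<dots> = ennreal (\<theta> ^ d) * (\<integral>\<^sup>+x. f (?T x) * gap N (?T ` \<Gamma> n) (?T x) powr s \<partial>lborel)"
      unfolding d by (rule nn_integral_dilation[OF _ \<theta>]) measurable
    also have "(\<integral>\<^sup>+x. f (?T x) * gap N (?T ` \<Gamma> n) (?T x) powr s \<partial>lborel)
        = (\<integral>\<^sup>+x. ennreal (\<theta> powr s) * ennreal (f x * (gap N (\<Gamma> n) x powr s * h x)) \<partial>lborel)"
    proof (rule nn_integral_cong_AE)
      show "AE x in lborel. ennreal (f (?T x) * gap N (?T ` \<Gamma> n) (?T x) powr s)
          = ennreal (\<theta> powr s) * ennreal (f x * (gap N (\<Gamma> n) x powr s * h x))"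
        using fh
      proof eventually_elim
        case (elim x)
        then show ?case using \<theta> h_nn f_nonneg gap_nonneg[OF G, of x]
          by (simp add: gap_dilation[OF G \<theta>] powr_mult mult_ac flip: ennreal_mult)
      qed
    qed
    also have "\<dots> = ennreal (\<theta> powr s) * (\<integral>\<^sup>+x. gap N (\<Gamma> n) x powr s * h x \<partial>P)"
      by (subst nn_P) (auto simp: nn_integral_cmult)
    also have "ennreal (\<theta> ^ d) * \<dots> \<le> ennreal (\<theta> ^ d) * (ennreal (\<theta> powr s) * ennreal (K * real n powr (- s / d) * I powr \<beta>))"
      using K(2)[OF n \<Gamma>_opt[OF n], of h I] h_nn I I_eq by (intro mult_left_mono) auto
    \<comment> \<open>The Jacobian gives \<open>\<theta> ^ d\<close> and the scaled gap
      \<open>\<theta> powr s\<close>; the root of order \<open>s\<close> will turn their product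
      into \<open>\<theta> powr (1 + d / s)\<close>.\<close>
    also have "\<dots> = ennreal (\<theta> powr (d + s) * (K * real n powr (- s / d) * I powr \<beta>))"
      using \<theta> K by (simp add: powr_add powr_realpow mult_ac flip: ennreal_mult)
    finally have "(\<integral>x. gap N (?T ` \<Gamma> n) x powr s \<partial>P) \<le> \<theta> powr (d + s) * (K * real n powr (- s / d) * I powr \<beta>)"
      using K by (intro integral_real_bounded) auto
    then have "quant_error N s (?T ` \<Gamma> n) P \<le> (\<theta> powr (d + s) * (K * real n powr (- s / d) * I powr \<beta>)) powr (1 / s)"
      unfolding quant_error_eq[OF TG s_pos] using s_pos by (intro powr_mono2) auto
    also have "\<dots> = K powr (1 / s) * \<theta> powr (1 + d / s) * I powr (\<beta> / s) * real n powr (- 1 / d)"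
    proof -
      have "(real d + s) * (1 / s) = 1 + d / s" using s_pos by (simp add: field_simps)
      then show ?thesis using \<theta> K s_pos by (simp add: powr_mult powr_powr)
    qed
    also have "\<dots> = kappa N r \<delta> \<eta> q p' 0 C * \<theta> powr (1 + d / s) * sigma_moment N \<rho> P * I powr (\<beta> / s) * real n powr (- 1 / d)"
      using sigma by (simp add: C)
    finally show "quant_error N s (?T ` \<Gamma> n) P
          \<le> kappa N r \<delta> \<eta> q p' 0 C * \<theta> powr (1 + d / s) * sigma_moment N (r + \<delta>) P *
            (LINT x:{x. f x > 0}|lborel. ratio_integrand f ((1 - q) * q') \<theta> \<mu> x)
              powr (1 / (\<bar>q\<bar> * q' * (d + r))) *
            real n powr (- 1 / d)"
      by (simp only: I_def \<rho>_def \<beta>_exp)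
  qed simp
qed

end
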